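(* Let $i\in\{2,3\}$, let $j$ be the other element of $\{2,3\}$, and let $\tau>0$ be an SINR threshold. In the network model of the context, the average outage probability $\mathcal{P}_{2,i}$ of the user connected to the $i$-th tier in Case 2 is $$\mathcal{P}_{2,i}=1-\frac{2\pi\lambda_i}{\mathbb{P}_{i,j}}\int_0^\infty x\,\exp\left\{-x^\beta P_i^{-1}\tau\sigma^2-\frac{\pi\lambda_i x^2}{\mathbb{P}_{i,j}}\left[1+\mathcal{Z}_1(\tau)+\frac{\lambda_1'}{\lambda_1}\frac{\mathcal{G}_{3,1}}{1-\mathcal{G}_{3,1}}\mathcal{Z}_2\right]\right\}\mathrm{d}x,$$ where $$\mathcal{Z}_2=\lim_{a\to0^+}\tau^{2/\beta}\,\frac{2a^{\frac{2-\beta}{2}}}{\beta-2}\,{}_2F_1\Big[1,1-\tfrac{2}{\beta};2-\tfrac{2}{\beta};-a^{-\beta/2}\Big].$$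
   Context: Parameters: real densities $\lambda_0>\lambda_2>\lambda_3>0$; $0<\alpha<1$; $\lambda_1=\alpha\lambda_0$; transmit powers $P_1,P_2,P_3>0$; path-loss exponent $\beta>2$; noise power $\sigma^2\ge 0$; integers $1\le M_1\le N$; $\gamma\ge 0$. The Zipf popularity is $f_n=n^{-\gamma}/\sum_{m=1}^N m^{-\gamma}$ for $1\le n\le N$, and $F(1,M_1)=\sum_{n=1}^{M_1}f_n$. Tier 1 consists of cache-enabled users, tier 2 of relays, tier 3 of base stations. Association probabilities: $\mathcal{G}_{3,1}=\Big[\sum_{m=1}^3\frac{\lambda_m}{\lambda_1}\big(\frac{P_m}{P_1}\big)^{2/\beta}\Big]^{-1}$ and, for $\{i,j\}=\{2,3\}$, $\mathbb{P}_{i,j}=\Big[\sum_{m=2}^3\frac{\lambda_m}{\lambda_i}\big(\frac{P_m}{P_i}\big)^{2/\beta}\Big]^{-1}$. Active densities: $\lambda_1'=\min\{\alpha\lambda_0,(1-\alpha)\lambda_0\,\mathcal{G}_{3,1}F(1,M_1)\}$, $\lambda_2'=\lambda_2$, $\lambda_3'=\lambda_3$. Case 2 model (the reference user, at the origin, is cache-enabled but its requested content is not cached at users; it is served by the node of maximal received power among tiers 2 and 3, lying in tier $i$): the distance $X_i$ from the reference user to its serving node has probability density $$\widehat f_{X_i}(x)=\frac{2\pi\lambda_i}{\mathbb{P}_{i,j}}\,x\,\exp\Big(-\pi x^2\sum_{m=2}^3\lambda_m\big(\tfrac{P_m}{P_i}\big)^{2/\beta}\Big),\quad x>0.$$ Conditionally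 on $X_i=x$, the interfering nodes of tiers $m=1,2,3$ form mutually independent homogeneous Poisson point processes of intensities $\lambda_m'$: for $m=2,3$ on $\{z\in\mathbb{R}^2:|z|\ge x(P_m/P_i)^{1/\beta}\}$, and for $m=1$ on all of $\mathbb{R}^2$ (tier-1 interferers can be arbitrarily close). All channel power gains ($g_{i,0}$ of the serving link and $h_{mk}$ of the interfering links) are i.i.d. $\exp(1)$ random variables, independent of all locations. With $|Y_{mk}|$ the distance from the origin to the $k$-th interferer of tier $m$, $$\mathrm{SINR}_i(x)=\frac{P_i g_{i,0}x^{-\beta}}{\sum_{m=1}^3\sum_k P_m h_{mk}|Y_{mk}|^{-\beta}+\sigma^2}.$$ The average outage probability is $\mathcal{P}_{2,i}=\int_0^\infty\mathbb{P}\big[\mathrm{SINR}_i(x)\le\tau\,\big|\,X_i=x\big]\widehat f_{X_i}(x)\,\mathrm{d}x$. Function: for $s>0$, $\mathcal{Z}_1(s)=\frac{2s}{\beta-2}\,{}_2F_1\big[1,1-\tfrac{2}{\beta};2-\tfrac{2}{\beta};-s\big]$, where ${}_2F_1$ is the Gauss hypergeometric function (analytically continued to $\mathbb{C}\setminus[1,\infty)$). *)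

theory Defs
  imports "HOL-Probability.Probability" "HOL-Complex_Analysis.Complex_Analysis"
begin

section \<open>Gauss hypergeometric function\<close>

text \<open>
  The function is given by the hypergeometric series on the unit disc and by its analytic
  continuation to the plane cut along \<open>[1, \<infinity>)\<close>. On that (connected) domain the continuation is
  unique, so the choice operator is only free outside of it.
\<close>

definition hyp2F1 :: "complex \<Rightarrow> complex \<Rightarrow> complex \<Rightarrow> complex \<Rightarrow> complex" where
  "hyp2F1 a b c = (SOME F. F holomorphic_on (- (of_real ` {1::real..})) \<and>
     (\<forall>z. norm z < 1 \<longrightarrow> F z = eval_fps (fps_hypergeo [a, b] [c] 1) z))"

text \<open>Real parameters and a real argument below 1 give a real value, so \<open>Re\<close> loses nothing.\<close>

definition real_hyp2F1 :: "real \<Rightarrow> real \<Rightarrow> real \<Rightarrow> real \<Rightarrow> real" where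
  "real_hyp2F1 a b c x = Re (hyp2F1 (of_real a) (of_real b) (of_real c) (of_real x))"

definition Z1 :: "real \<Rightarrow> real \<Rightarrow> real" where
  "Z1 \<beta> s = 2 * s / (\<beta> - 2) * real_hyp2F1 1 (1 - 2 / \<beta>) (2 - 2 / \<beta>) (- s)"

definition Z2_approx :: "real \<Rightarrow> real \<Rightarrow> real \<Rightarrow> real" where
  "Z2_approx \<beta> \<tau> a = \<tau> powr (2 / \<beta>) * (2 * a powr ((2 - \<beta>) / 2) / (\<beta> - 2)) *
     real_hyp2F1 1 (1 - 2 / \<beta>) (2 - 2 / \<beta>) (- (a powr (- \<beta> / 2)))"

definition Z2 :: "real \<Rightarrow> real \<Rightarrow> real" where
  "Z2 \<beta> \<tau> = Lim (at_right 0) (Z2_approx \<beta> \<tau>)"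


section \<open>Network parameters\<close>

definition zipf :: "real \<Rightarrow> nat \<Rightarrow> nat \<Rightarrow> real" where
  "zipf \<gamma> N n = real n powr (- \<gamma>) / (\<Sum>m = 1..N. real m powr (- \<gamma>))"

definition cached_mass :: "real \<Rightarrow> nat \<Rightarrow> nat \<Rightarrow> nat \<Rightarrow> real" where
  "cached_mass \<gamma> N a b = (\<Sum>n = a..b. zipf \<gamma> N n)"

text \<open>
  Probability that the strongest node among the tiers in \<open>S\<close> belongs to tier \<open>i\<close>:
  \<open>G\<^bsub>3,1\<^esub>\<close> is the case \<open>S = {1..3}\<close>, \<open>i = 1\<close>, and \<open>P\<^bsub>i,j\<^esub>\<close> is the case \<open>S = {2..3} = {i, j}\<close>.
\<close>

definition assoc_prob :: "(nat \<Rightarrow> real) \<Rightarrow> (nat \<Rightarrow> real) \<Rightarrow> real \<Rightarrow> nat set \<Rightarrow> nat \<Rightarrow> real" where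
  "assoc_prob lam P \<beta> S i = inverse (\<Sum>m\<in>S. lam m / lam i * (P m / P i) powr (2 / \<beta>))"

text \<open>Index 0 of \<open>lam\<close> is the density of all users, indices 1 to 3 are the three tiers.\<close>

definition active_density ::
    "real \<Rightarrow> (nat \<Rightarrow> real) \<Rightarrow> (nat \<Rightarrow> real) \<Rightarrow> real \<Rightarrow> real \<Rightarrow> nat \<Rightarrow> nat \<Rightarrow> nat \<Rightarrow> real" where
  "active_density \<alpha> lam P \<beta> \<gamma> N M1 m =
     (if m = 1
      then min (\<alpha> * lam 0)
               ((1 - \<alpha>) * lam 0 * assoc_prob lam P \<beta> {1..3} 1 * cached_mass \<gamma> N 1 M1)
      else lam m)"

definition serving_distance_density ::
    "(nat \<Rightarrow> real) \<Rightarrow> (nat \<Rightarrow> real) \<Rightarrow> real \<Rightarrow> nat \<Rightarrow> real \<Rightarrow> real" where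
  "serving_distance_density lam P \<beta> i x =
     (if x > 0
      then 2 * pi * lam i / assoc_prob lam P \<beta> {2..3} i * x *
           exp (- pi * x\<^sup>2 * (\<Sum>m = 2..3. lam m * (P m / P i) powr (2 / \<beta>)))
      else 0)"


section \<open>Poisson point processes\<close>

text \<open>
  A point process with infinitely many points is an enumeration \<open>Y\<close> of random points; the number
  of points in a set may be infinite, hence takes values in the extended nonnegative reals.
\<close>

definition point_count :: "(nat \<Rightarrow> 'w \<Rightarrow> 'b) \<Rightarrow> 'b set \<Rightarrow> 'w \<Rightarrow> ennreal" where
  "point_count Y A \<omega> = (\<Sum>k. indicator A (Y k \<omega>))"

text \<open>
  The Poisson weights are written out since the library distribution requires a positive rate,
  whereas null sets have rate 0.
\<close>

definition poisson_process :: "'w measure \<Rightarrow> 'b measure \<Rightarrow> (nat \<Rightarrow> 'w \<Rightarrow> 'b) \<Rightarrow> bool" where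
  "poisson_process M \<mu> Y \<longleftrightarrow>
     (\<forall>k. Y k \<in> measurable M \<mu>) \<and>
     (\<forall>A\<in>sets \<mu>. emeasure \<mu> A < \<infinity> \<longrightarrow>
        (\<forall>n::nat. measure M {\<omega> \<in> space M. point_count Y A \<omega> = of_nat n} =
           measure \<mu> A ^ n / fact n * exp (- measure \<mu> A))) \<and>
     (\<forall>(I::nat set) A. finite I \<longrightarrow> disjoint_family_on A I \<longrightarrow> A ` I \<subseteq> sets \<mu> \<longrightarrow>
        prob_space.indep_vars M (\<lambda>_. borel) (\<lambda>l. point_count Y (A l)) I)"

definition homogeneous_poisson_process ::
    "'w measure \<Rightarrow> real \<Rightarrow> 'b::euclidean_space set \<Rightarrow> (nat \<Rightarrow> 'w \<Rightarrow> 'b) \<Rightarrow> bool" where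
  "homogeneous_poisson_process M r D Y \<longleftrightarrow>
     poisson_process M (density lborel (\<lambda>z. ennreal r * indicator D z)) Y"


section \<open>Signal, interference and outage\<close>

text \<open>
  The interference series and the quotient are formed in the extended nonnegative reals, so that
  neither depends on summability. Points at the origin, negative gains and a vanishing denominator
  have probability 0 in the model below.
\<close>

definition interference ::
    "(nat \<Rightarrow> real) \<Rightarrow> real \<Rightarrow> (nat \<Rightarrow> nat \<Rightarrow> 'w \<Rightarrow> real) \<Rightarrow> (nat \<Rightarrow> nat \<Rightarrow> 'w \<Rightarrow> real ^ 2) \<Rightarrow>
     'w \<Rightarrow> ennreal" where
  "interference P \<beta> h Y \<omega> =
     (\<Sum>m = 1..3. \<Sum>k. ennreal (P m * h m k \<omega> * norm (Y m k \<omega>) powr (- \<beta>)))"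

definition sinr ::
    "(nat \<Rightarrow> real) \<Rightarrow> real \<Rightarrow> real \<Rightarrow> nat \<Rightarrow> ('w \<Rightarrow> real) \<Rightarrow> (nat \<Rightarrow> nat \<Rightarrow> 'w \<Rightarrow> real) \<Rightarrow>
     (nat \<Rightarrow> nat \<Rightarrow> 'w \<Rightarrow> real ^ 2) \<Rightarrow> real \<Rightarrow> 'w \<Rightarrow> ennreal" where
  "sinr P \<beta> noise i g h Y x \<omega> =
     ennreal (P i * g \<omega> * x powr (- \<beta>)) / (interference P \<beta> h Y \<omega> + ennreal noise)"

text \<open>A version \<open>Q\<close> of the conditional probability given \<open>X = x\<close>.\<close>

definition regular_conditional_prob ::
    "'w measure \<Rightarrow> ('w \<Rightarrow> real) \<Rightarrow> (real \<Rightarrow> 'w measure) \<Rightarrow> bool" where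
  "regular_conditional_prob M X Q \<longleftrightarrow>
     Q \<in> measurable borel (prob_algebra M) \<and>
     (\<forall>A\<in>sets M. \<forall>B\<in>sets borel.
        emeasure M (A \<inter> X -` B) = (\<integral>\<^sup>+x\<in>B. emeasure (Q x) A \<partial>distr M borel X))"

definition tier_region :: "(nat \<Rightarrow> real) \<Rightarrow> real \<Rightarrow> nat \<Rightarrow> real \<Rightarrow> nat \<Rightarrow> (real ^ 2) set" where
  "tier_region P \<beta> i x m =
     (if m = 1 then UNIV else {z. norm z \<ge> x * (P m / P i) powr (1 / \<beta>)})"

text \<open>
  The law of interferers and gains on a probability space \<open>M\<close> for serving distance \<open>x\<close>; \<open>r m\<close> is
  the intensity of the interferers of tier \<open>m\<close>. Independence of the tiers is
  that of their families of counts, i.e. of the unordered point configurations. In the family of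
  gains, \<open>None\<close> indexes the serving link and \<open>Some (m, k)\<close> the \<open>k\<close>-th interferer of tier \<open>m\<close>.
\<close>

abbreviation (input) interferer_index :: "(nat \<times> nat) set" where
  "interferer_index \<equiv> {1..3} \<times> UNIV"

abbreviation (input) link_index :: "(nat \<times> nat) option set" where
  "link_index \<equiv> insert None (Some ` interferer_index)"

definition gain :: "('w \<Rightarrow> real) \<Rightarrow> (nat \<Rightarrow> nat \<Rightarrow> 'w \<Rightarrow> real) \<Rightarrow> (nat \<times> nat) option \<Rightarrow> 'w \<Rightarrow> real" where
  "gain g h l = (case l of None \<Rightarrow> g | Some (m, k) \<Rightarrow> h m k)"

definition interference_model ::
    "'w measure \<Rightarrow> (nat \<Rightarrow> real) \<Rightarrow> (nat \<Rightarrow> real) \<Rightarrow> real \<Rightarrow> nat \<Rightarrow> ('w \<Rightarrow> real) \<Rightarrow>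
     (nat \<Rightarrow> nat \<Rightarrow> 'w \<Rightarrow> real) \<Rightarrow> (nat \<Rightarrow> nat \<Rightarrow> 'w \<Rightarrow> real ^ 2) \<Rightarrow> real \<Rightarrow> bool" where
  "interference_model M r P \<beta> i g h Y x \<longleftrightarrow>
     (\<forall>m\<in>{1..3}. homogeneous_poisson_process M (r m) (tier_region P \<beta> i x m) (Y m)) \<and>
     prob_space.indep_vars M (\<lambda>_. PiM (sets borel) (\<lambda>_. borel))
       (\<lambda>m \<omega>. \<lambda>A\<in>sets borel. point_count (Y m) A \<omega>) {1..3} \<and>
     (\<forall>l\<in>link_index. distributed M lborel (gain g h l) (exponential_density 1)) \<and>
     prob_space.indep_vars M (\<lambda>_. borel) (gain g h) link_index \<and>
     prob_space.indep_set M
       (sets (vimage_algebra (space M) (\<lambda>\<omega>. \<lambda>l\<in>link_index. gain g h l \<omega>)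
          (PiM link_index (\<lambda>_. borel))))
       (sets (vimage_algebra (space M) (\<lambda>\<omega>. \<lambda>(m, k)\<in>interferer_index. Y m k \<omega>)
          (PiM interferer_index (\<lambda>_. borel))))"

text \<open>
  The whole model: \<open>X\<close> is the serving distance, and the law of interferers and gains given \<open>X = x\<close>
  is prescribed for almost every \<open>x\<close>, since a conditional probability is determined only up to
  null sets.
\<close>

definition case2_model ::
    "'w measure \<Rightarrow> ('w \<Rightarrow> real) \<Rightarrow> (real \<Rightarrow> 'w measure) \<Rightarrow> (nat \<Rightarrow> real) \<Rightarrow> (nat \<Rightarrow> real) \<Rightarrow>
     (nat \<Rightarrow> real) \<Rightarrow> real \<Rightarrow> nat \<Rightarrow> ('w \<Rightarrow> real) \<Rightarrow> (nat \<Rightarrow> nat \<Rightarrow> 'w \<Rightarrow> real) \<Rightarrow>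
     (nat \<Rightarrow> nat \<Rightarrow> 'w \<Rightarrow> real ^ 2) \<Rightarrow> bool" where
  "case2_model M X Q lam r P \<beta> i g h Y \<longleftrightarrow>
     prob_space M \<and>
     distributed M lborel X (\<lambda>x. ennreal (serving_distance_density lam P \<beta> i x)) \<and>
     regular_conditional_prob M X Q \<and>
     (AE x in distr M borel X. interference_model (Q x) r P \<beta> i g h Y x)"

definition outage_prob ::
    "(real \<Rightarrow> 'w measure) \<Rightarrow> (nat \<Rightarrow> real) \<Rightarrow> (nat \<Rightarrow> real) \<Rightarrow> real \<Rightarrow> real \<Rightarrow> nat \<Rightarrow>
     ('w \<Rightarrow> real) \<Rightarrow> (nat \<Rightarrow> nat \<Rightarrow> 'w \<Rightarrow> real) \<Rightarrow> (nat \<Rightarrow> nat \<Rightarrow> 'w \<Rightarrow> real ^ 2) \<Rightarrow> real \<Rightarrow> real" where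
  "outage_prob Q lam P \<beta> noise i g h Y \<tau> =
     (LBINT x:{0<..}.
        measure (Q x) {\<omega> \<in> space (Q x). sinr P \<beta> noise i g h Y x \<omega> \<le> ennreal \<tau>} *
        serving_distance_density lam P \<beta> i x)"

end

theory Submission
  imports Defs
begin

text \<open>
  Since the serving gain is exponential, coverage given the distance \<open>x\<close>, the interferers and their
  gains has probability \<open>exp (- s (I + noise))\<close> with \<open>s = \<tau> x powr \<beta> / P i\<close>. Averaging over the
  exponential interferer gains turns this into \<open>exp\<close> of minus a sum of \<open>ln (1 + s P m |y| powr (- \<beta>))\<close>
  over the interferers, to which the Laplace functional of a Poisson process applies, with exponent
  \<open>\<integral> (1 - exp (- v)) d\<mu> = \<integral> s P m |y| powr (- \<beta>) / (1 + s P m |y| powr (- \<beta>)) d\<mu>\<close>. The substitution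
  \<open>u = (d / |y|) powr (\<beta> - 2)\<close> maps the region \<open>|y| \<ge> d\<close> to the unit interval and the integral to the Euler
  integral of the hypergeometric function. Letting \<open>d\<close> tend to 0 gives \<open>Z2\<close>, because the disc of
  radius \<open>d\<close> contributes at most its area.
\<close>

text \<open>The independence assumptions dictate the order of averaging. The family of all gains is
  independent of the family of all positions, but the tiers are independent of each other only as
  unordered configurations; their enumerations may be coupled. Hence the gains are integrated out
  with the positions frozen. What remains is a sum over the points of each tier, which no longer
  depends on their numbering, and only there is the independence of the tiers used.

  Two features explain the shape of the result. For tiers 2 and 3 the exclusion radius is where an
  interferer is on average as strong as the server, so the hypergeometric argument is \<tau>
  whatever \<open>x\<close> and the tier are. The summand 1 in the bracket is not interference: it
  is the exponent of the serving distance density. Finally, \<open>Z2\<close> is defined by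
  \<open>Lim\<close>, which carries information only together with a proof of convergence, so
  convergence is part of the claim.\<close>

section \<open>The Laplace functional of a Poisson process\<close>

text \<open>
  The exponential \<open>exp (- t)\<close> on \<open>[0, \<infinity>]\<close>, with value 0 at \<open>\<infinity>\<close>: the interference may be infinite, and
  no summability has to be established.
\<close>

definition exp_neg :: "ennreal \<Rightarrow> ennreal" where
  "exp_neg t = (if t = \<infinity> then 0 else ennreal (exp (- enn2real t)))"

lemma exp_neg_ennreal: "x \<ge> 0 \<Longrightarrow> exp_neg (ennreal x) = ennreal (exp (- x))"
  by (simp add: exp_neg_def)

lemma exp_neg_top [simp]: "exp_neg top = 0"
  by (simp add: exp_neg_def)

lemma exp_neg_0 [simp]: "exp_neg 0 = 1"
  by (simp add: exp_neg_def)

lemma exp_neg_le_1: "exp_neg t \<le> 1"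
  by (simp add: exp_neg_def)

lemma exp_neg_add: "exp_neg (a + b) = exp_neg a * exp_neg b"
  by (cases a; cases b) (auto simp: exp_neg_def ennreal_mult[symmetric] simp flip: ennreal_plus exp_add)

lemma exp_neg_antimono: "a \<le> b \<Longrightarrow> exp_neg b \<le> exp_neg a"
  by (cases a; cases b) (auto simp: exp_neg_def top_unique)

lemma exp_neg_sum: "exp_neg (\<Sum>i\<in>I. f i) = (\<Prod>i\<in>I. exp_neg (f i))"
  by (induction I rule: infinite_finite_induct) (auto simp: exp_neg_add)

text \<open>Continuity on all of [0, \<infinity>]. The point \<infinity> needs its own argument
  because \<open>enn2real\<close> sends it to 0; including it lets limits pass through
  \<open>exp_neg\<close> without any summability condition.\<close>

lemma tendsto_exp_neg [tendsto_intros]: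
  assumes "(f \<longlongrightarrow> a) F"
  shows "((\<lambda>x. exp_neg (f x)) \<longlongrightarrow> exp_neg a) F"
proof (cases "a = \<infinity>")
  case False
  then have ev: "eventually (\<lambda>x. f x < \<infinity>) F"
    using assms by (intro order_tendstoD) (auto simp: less_top)
  have "((\<lambda>x. ennreal (exp (- enn2real (f x)))) \<longlongrightarrow> ennreal (exp (- enn2real a))) F"
    using False by (intro tendsto_intros tendsto_enn2real assms) (use assms in \<open>auto simp: less_top\<close>)
  then show ?thesis
    by (rule Lim_transform_eventually[THEN tendsto_eq_rhs])
      (use False ev in \<open>auto simp: exp_neg_def elim!: eventually_mono\<close>)
next
  case True
  have "eventually (\<lambda>x. exp_neg (f x) < e) F" if "e > 0" for e :: ennreal
  proof (cases "e \<le> 1")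
    case le: True
    then obtain r where r: "e = ennreal r" "r > 0" "r \<le> 1"
      using \<open>e > 0\<close> by (cases e) (auto simp: top_unique)
    \<comment> \<open>Beyond the level \<open>- ln r\<close> the exponential is below
      \<open>r\<close>. Since \<open>r\<close> is at most 1 this level is nonnegative, so
      \<open>ennreal\<close> does not truncate it.\<close>
    have "eventually (\<lambda>x. f x > ennreal (- ln r)) F"
      using assms True by (intro order_tendstoD) auto
    then show ?thesis
    proof eventually_elim
      case (elim x)
      show ?case
      proof (cases "f x")
        case (real t)
        then have "- ln r < t" using elim r by (simp add: ennreal_less_iff)
        then have "exp (- t) < r"
          using r by (metis exp_less_cancel_iff exp_ln minus_less_iff)
        then show ?thesis using real r by (simp add: exp_neg_ennreal ennreal_less_iff)
      qed (use \<open>e > 0\<close> in auto)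
    qed
  next
    case False
    then show ?thesis
      by (intro always_eventually allI le_less_trans[OF exp_neg_le_1]) simp
  qed
  then show ?thesis
    unfolding True infinity_ennreal_def exp_neg_top by (intro order_tendstoI) auto
qed

lemma measurable_exp_neg [measurable]: "exp_neg \<in> borel_measurable borel"
  by (intro borel_measurable_continuous_onI continuous_at_imp_continuous_on)
     (auto simp: isCont_def intro!: tendsto_intros)

section \<open>Laplace transforms of Poisson counts and of sums over the points\<close>

lemma measurable_point_count [measurable]:
  assumes "\<And>k. Y k \<in> M \<rightarrow>\<^sub>M N" "A \<in> sets N"
  shows "point_count Y A \<in> borel_measurable M"
proof -
  note assms[measurable]
  show ?thesis unfolding point_count_def by measurable
qed

text \<open>The factor \<open>exp (- c) ^ n\<close> turns the exponential series in the mean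
  \<open>measure \<mu> A\<close> into the one in \<open>exp (- c) * measure \<mu> A\<close>.\<close>

lemma (in prob_space) nn_integral_exp_neg_point_count:
  assumes Y: "poisson_process M \<mu> Y" and A: "A \<in> sets \<mu>" "emeasure \<mu> A < \<infinity>" and c: "c \<ge> 0"
  shows "(\<integral>\<^sup>+\<omega>. exp_neg (ennreal c * point_count Y A \<omega>) \<partial>M) =
    ennreal (exp (- ((1 - exp (- c)) * measure \<mu> A)))"
proof -
  have [measurable]: "\<And>k. Y k \<in> M \<rightarrow>\<^sub>M \<mu>" and
    pr: "\<And>n::nat. prob {\<omega> \<in> space M. point_count Y A \<omega> = of_nat n} =
      measure \<mu> A ^ n / fact n * exp (- measure \<mu> A)"
    using Y A by (auto simp: poisson_process_def)
  have [measurable]: "point_count Y A \<in> borel_measurable M"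
    using A by measurable
  define E where "E n = {\<omega> \<in> space M. point_count Y A \<omega> = of_nat n}" for n
  have [measurable]: "E n \<in> sets M" for n
    unfolding E_def by measurable
  have disj: "disjoint_family E"
    by (auto simp: disjoint_family_on_def E_def)
  have exps: "(\<lambda>n. x ^ n / fact n * y) sums (exp x * y)" for x y :: real
    using sums_mult2[OF exp_converges[of x], of y] by (simp add: field_simps)
  \<comment> \<open>The Poisson weights add up to 1, so the count is almost surely a natural number;
    this is what rules out the value \<infinity>.\<close>
  have "(\<lambda>n. prob (E n)) sums prob (\<Union>n. E n)"
    using disj by (intro finite_measure_UNION) auto
  moreover have "(\<lambda>n. prob (E n)) sums (exp (measure \<mu> A) * exp (- measure \<mu> A))"
    unfolding E_def pr by (rule exps)
  ultimately have "prob (\<Union>n. E n) = 1"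
    by (simp add: sums_unique2 exp_minus)
  then have AE: "AE \<omega> in M. \<omega> \<in> (\<Union>n. E n)"
    by (intro AE_in_set_eq_1[THEN iffD2]) auto
  have "(\<integral>\<^sup>+\<omega>. exp_neg (ennreal c * point_count Y A \<omega>) \<partial>M) =
      (\<integral>\<^sup>+\<omega>. (\<Sum>n. ennreal (exp (- (c * n))) * indicator (E n) \<omega>) \<partial>M)"
  proof (rule nn_integral_cong_AE, use AE in eventually_elim)
    case (elim \<omega>)
    then obtain n where n: "\<omega> \<in> E n" by auto
    then have "indicator (E m) \<omega> = (if m = n then 1 else 0 :: ennreal)" for m
      using disj by (auto simp: disjoint_family_on_def indicator_def)
    then have "(\<Sum>n. ennreal (exp (- (c * n))) * indicator (E n) \<omega>) =
        (\<Sum>m\<in>{n}. ennreal (exp (- (c * m))) * indicator (E m) \<omega>)"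
      by (intro suminf_finite) auto
    also have "\<dots> = ennreal (exp (- (c * n)))"
      using n by simp
    also have "\<dots> = exp_neg (ennreal c * point_count Y A \<omega>)"
      using n c by (simp add: E_def exp_neg_ennreal ennreal_of_nat_eq_real_of_nat ennreal_mult[symmetric])
    finally show ?case ..
  qed
  also have "\<dots> = (\<Sum>n. \<integral>\<^sup>+\<omega>. ennreal (exp (- (c * n))) * indicator (E n) \<omega> \<partial>M)"
    by (intro nn_integral_suminf) measurable
  also have "\<dots> = (\<Sum>n. ennreal ((exp (- c) * measure \<mu> A) ^ n / fact n * exp (- measure \<mu> A)))"
  proof (intro suminf_cong)
    fix n :: nat
    have "(\<integral>\<^sup>+\<omega>. ennreal (exp (- (c * n))) * indicator (E n) \<omega> \<partial>M) = ennreal (exp (- (c * n))) * ennreal (prob (E n))"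
      by (subst nn_integral_cmult_indicator) (auto simp: emeasure_eq_measure)
    also have "\<dots> = ennreal (exp (- (c * n)) * (measure \<mu> A ^ n / fact n * exp (- measure \<mu> A)))"
      unfolding E_def pr by (intro ennreal_mult[symmetric]) auto
    also have "exp (- (c * n)) * (measure \<mu> A ^ n / fact n * exp (- measure \<mu> A)) =
        (exp (- c) * measure \<mu> A) ^ n / fact n * exp (- measure \<mu> A)"
      by (simp add: power_mult_distrib mult.commute flip: exp_of_nat_mult)
    finally show "(\<integral>\<^sup>+\<omega>. ennreal (exp (- (c * n))) * indicator (E n) \<omega> \<partial>M) =
        ennreal ((exp (- c) * measure \<mu> A) ^ n / fact n * exp (- measure \<mu> A))"
      .
  qed
  also have "\<dots> = ennreal (exp (exp (- c) * measure \<mu> A) * exp (- measure \<mu> A))"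
    using exps by (intro suminf_ennreal_eq) auto
  also have "exp (exp (- c) * measure \<mu> A) * exp (- measure \<mu> A) = exp (- ((1 - exp (- c)) * measure \<mu> A))"
    by (simp flip: exp_add add: algebra_simps)
  finally show ?thesis .
qed

text \<open>
  The model states independence of the tiers only for their counts. Additive functionals of a
  configuration are measurable functions of the counts, hence inherit this independence.
\<close>

lemma suminf_eq_counts:
  fixes v :: "'b \<Rightarrow> ennreal"
  assumes "v \<in> borel_measurable \<mu>"
  shows "\<exists>\<Phi>\<in>borel_measurable (PiM (sets \<mu>) (\<lambda>_. borel)). \<forall>(Y :: nat \<Rightarrow> 'w \<Rightarrow> 'b) \<omega>.
    (\<forall>k. Y k \<omega> \<in> space \<mu>) \<longrightarrow> (\<Sum>k. v (Y k \<omega>)) = \<Phi> (\<lambda>A\<in>sets \<mu>. point_count Y A \<omega>)"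
  using assms
proof (induction rule: borel_measurable_induct)
  case (cong f g)
  then show ?case by simp
next
  case (set A)
  then show ?case
    \<comment> \<open>For an indicator the sum is itself a count, that is, one coordinate of the
      family. Linear combinations and monotone limits then extend the claim to all measurable
      functions.\<close>
    by (intro bexI[of _ "\<lambda>n. n A"]) (auto simp: point_count_def intro!: measurable_component_singleton)
next
  case (mult u c)
  then obtain \<Phi> where [measurable]: "\<Phi> \<in> borel_measurable (PiM (sets \<mu>) (\<lambda>_. borel))"
    and \<Phi>: "\<And>(Y :: nat \<Rightarrow> 'w \<Rightarrow> 'b) \<omega>. (\<forall>k. Y k \<omega> \<in> space \<mu>) \<Longrightarrow> (\<Sum>k. u (Y k \<omega>)) = \<Phi> (\<lambda>A\<in>sets \<mu>. point_count Y A \<omega>)"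
    by blast
  show ?case
    by (intro bexI[of _ "\<lambda>n. c * \<Phi> n"]) (auto simp: \<Phi> ennreal_suminf_cmult restrict_def)
next
  case (add u v)
  then obtain \<Phi> \<Psi> where [measurable]: "\<Phi> \<in> borel_measurable (PiM (sets \<mu>) (\<lambda>_. borel))"
      "\<Psi> \<in> borel_measurable (PiM (sets \<mu>) (\<lambda>_. borel))"
    and \<Phi>: "\<And>(Y :: nat \<Rightarrow> 'w \<Rightarrow> 'b) \<omega>. (\<forall>k. Y k \<omega> \<in> space \<mu>) \<Longrightarrow> (\<Sum>k. u (Y k \<omega>)) = \<Phi> (\<lambda>A\<in>sets \<mu>. point_count Y A \<omega>)"
      "\<And>(Y :: nat \<Rightarrow> 'w \<Rightarrow> 'b) \<omega>. (\<forall>k. Y k \<omega> \<in> space \<mu>) \<Longrightarrow> (\<Sum>k. v (Y k \<omega>)) = \<Psi> (\<lambda>A\<in>sets \<mu>. point_count Y A \<omega>)"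
    by blast
  show ?case
    by (intro bexI[of _ "\<lambda>n. \<Psi> n + \<Phi> n"]) (auto simp: \<Phi> suminf_add[symmetric] restrict_def)
next
  case (seq U)
  then have "\<forall>i. \<exists>\<Phi>. \<Phi> \<in> borel_measurable (PiM (sets \<mu>) (\<lambda>_. borel)) \<and> (\<forall>(Y :: nat \<Rightarrow> 'w \<Rightarrow> 'b) \<omega>.
    (\<forall>k. Y k \<omega> \<in> space \<mu>) \<longrightarrow> (\<Sum>k. U i (Y k \<omega>)) = \<Phi> (\<lambda>A\<in>sets \<mu>. point_count Y A \<omega>))"
    by blast
  then obtain \<Phi> where [measurable]: "\<And>i. \<Phi> i \<in> borel_measurable (PiM (sets \<mu>) (\<lambda>_. borel))"
    and \<Phi>: "\<And>i (Y :: nat \<Rightarrow> 'w \<Rightarrow> 'b) \<omega>. (\<forall>k. Y k \<omega> \<in> space \<mu>) \<Longrightarrow>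
      (\<Sum>k. U i (Y k \<omega>)) = \<Phi> i (\<lambda>A\<in>sets \<mu>. point_count Y A \<omega>)"
    by metis
  have "(\<Sum>k. SUP i. U i (y k)) = (SUP i. \<Sum>k. U i (y k))" for y :: "nat \<Rightarrow> 'b"
    using \<open>incseq U\<close> by (intro ennreal_suminf_SUP_eq) (auto simp: incseq_def le_fun_def)
  then show ?case
    by (intro bexI[of _ "\<lambda>n. SUP i. \<Phi> i n"]) (auto simp: \<Phi> image_comp restrict_def)
qed

text \<open>The sum is a finite combination of the counts of the level sets of \<open>u\<close>.
  These sets are disjoint and of finite measure, so the counts are independent Poisson variables and
  the expectation factorises.\<close>

lemma (in prob_space) laplace_functional_simple:
  assumes Y: "poisson_process M \<mu> Y" and u: "simple_function \<mu> u" "\<And>x. x \<in> space \<mu> \<Longrightarrow> u x < \<infinity>"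
    and supp: "emeasure \<mu> {x \<in> space \<mu>. u x \<noteq> 0} < \<infinity>"
  shows "(\<integral>\<^sup>+\<omega>. exp_neg (\<Sum>k. u (Y k \<omega>)) \<partial>M) = exp_neg (\<integral>\<^sup>+x. 1 - exp_neg (u x) \<partial>\<mu>)"
proof -
  have [measurable]: "\<And>k. Y k \<in> M \<rightarrow>\<^sub>M \<mu>" and
    ind: "\<And>(I :: nat set) A. finite I \<Longrightarrow> disjoint_family_on A I \<Longrightarrow> A ` I \<subseteq> sets \<mu> \<Longrightarrow>
      indep_vars (\<lambda>_. borel) (\<lambda>l. point_count Y (A l)) I"
    using Y by (auto simp: poisson_process_def)
  define F where "F = u ` space \<mu> - {0}"
  have "finite F"
    using u by (auto simp: F_def simple_function_def)
  \<comment> \<open>The nonzero values are numbered because a Poisson process provides independence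
    for families of sets indexed by natural numbers. The level set of 0 is left out, as its measure
    may be infinite.\<close>
  then obtain f where f: "bij_betw f {0..<card F} F"
    using ex_bij_betw_nat_finite by blast
  define J where "J = {0..<card F}"
  define A where "A l = u -` {f l} \<inter> space \<mu>" for l
  have fF: "f l \<in> F" if "l \<in> J" for l
    using f that by (auto simp: bij_betw_def J_def)
  have inj: "inj_on f J"
    using f by (auto simp: bij_betw_def J_def)
  have A[measurable]: "A l \<in> sets \<mu>" for l
    unfolding A_def using simple_functionD(2)[OF u(1)] by simp
  have disj: "disjoint_family_on A J"
    using inj by (auto simp: disjoint_family_on_def A_def inj_on_def)
  have fin: "emeasure \<mu> (A l) < \<infinity>" if "l \<in> J" for l
  proof -
    have "A l \<subseteq> {x \<in> space \<mu>. u x \<noteq> 0}"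
      using fF[OF that] by (auto simp: A_def F_def)
    moreover have "{x \<in> space \<mu>. u x \<noteq> 0} \<in> sets \<mu>"
      using borel_measurable_simple_function[OF u(1)] by measurable
    ultimately show ?thesis
      using supp by (meson emeasure_mono le_less_trans)
  qed
  \<comment> \<open>Used twice: with the identity for the sum over the points, and with
    \<open>1 - exp_neg\<close> of a value for the exponent. Both functions vanish at 0, which
    accounts for the missing level set.\<close>
  have rep: "(\<Sum>l\<in>J. \<phi> (f l) * indicator (A l) x) = \<phi> (u x)"
    if "x \<in> space \<mu>" "\<phi> 0 = 0" for x and \<phi> :: "ennreal \<Rightarrow> ennreal"
  proof (cases "u x = 0")
    case True
    then have "x \<notin> A l" if "l \<in> J" for l
      using fF[OF that] by (auto simp: A_def F_def)
    then show ?thesis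
      using True that by (auto intro!: sum.neutral)
  next
    case False
    then have "u x \<in> f ` J"
      using f \<open>x \<in> space \<mu>\<close> by (simp add: bij_betw_def J_def F_def)
    then obtain l where l: "l \<in> J" "f l = u x"
      by auto
    have "(\<Sum>l'\<in>J. \<phi> (f l') * indicator (A l') x) = (\<Sum>l'\<in>{l}. \<phi> (f l') * indicator (A l') x)"
      using l inj by (intro sum.mono_neutral_right) (auto simp: A_def J_def inj_on_def indicator_def split: if_splits)
    then show ?thesis
      using l that by (simp add: A_def)
  qed
  have sp: "Y k \<omega> \<in> space \<mu>" if "\<omega> \<in> space M" for k \<omega>
    using that by (meson \<open>\<And>k. Y k \<in> M \<rightarrow>\<^sub>M \<mu>\<close> measurable_space)
  have eq: "(\<Sum>k. u (Y k \<omega>)) = (\<Sum>l\<in>J. f l * point_count Y (A l) \<omega>)" if "\<omega> \<in> space M" for \<omega>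
  proof -
    have "(\<Sum>k. u (Y k \<omega>)) = (\<Sum>k. \<Sum>l\<in>J. f l * indicator (A l) (Y k \<omega>))"
      using rep[OF sp[OF that], of "\<lambda>x. x"] by simp
    also have "\<dots> = (\<Sum>l\<in>J. \<Sum>k. f l * indicator (A l) (Y k \<omega>))"
      by (rule suminf_sum) auto
    finally show ?thesis
      by (simp add: point_count_def)
  qed
  have "(\<integral>\<^sup>+\<omega>. exp_neg (\<Sum>k. u (Y k \<omega>)) \<partial>M) = (\<integral>\<^sup>+\<omega>. (\<Prod>l\<in>J. exp_neg (f l * point_count Y (A l) \<omega>)) \<partial>M)"
    by (intro nn_integral_cong) (simp add: eq exp_neg_sum)
  also have "\<dots> = (\<Prod>l\<in>J. \<integral>\<^sup>+\<omega>. exp_neg (f l * point_count Y (A l) \<omega>) \<partial>M)"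
    by (intro indep_vars_nn_integral indep_vars_compose2[where Y="\<lambda>l c. exp_neg (f l * c)", OF ind])
       (use disj in \<open>auto simp: J_def\<close>)
  also have "\<dots> = (\<Prod>l\<in>J. exp_neg ((1 - exp_neg (f l)) * emeasure \<mu> (A l)))"
  proof (intro prod.cong refl)
    fix l assume l: "l \<in> J"
    have "f l < \<infinity>" using fF[OF l] u(2) by (auto simp: F_def)
    then obtain c where c: "f l = ennreal c" "c \<ge> 0"
      by (cases "f l") auto
    have "(1 - exp_neg (f l)) * emeasure \<mu> (A l) = ennreal ((1 - exp (- c)) * measure \<mu> (A l))"
      using c fin[OF l] by (simp add: exp_neg_ennreal emeasure_eq_ennreal_measure ennreal_mult less_top
          flip: ennreal_1 ennreal_minus)
    then show "(\<integral>\<^sup>+\<omega>. exp_neg (f l * point_count Y (A l) \<omega>) \<partial>M) = exp_neg ((1 - exp_neg (f l)) * emeasure \<mu> (A l))"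
      using nn_integral_exp_neg_point_count[OF Y A fin[OF l] c(2)] c by (simp add: exp_neg_ennreal)
  qed
  also have "\<dots> = exp_neg (\<Sum>l\<in>J. (1 - exp_neg (f l)) * emeasure \<mu> (A l))"
    by (simp add: exp_neg_sum)
  also have "(\<Sum>l\<in>J. (1 - exp_neg (f l)) * emeasure \<mu> (A l)) = (\<integral>\<^sup>+x. (\<Sum>l\<in>J. (1 - exp_neg (f l)) * indicator (A l) x) \<partial>\<mu>)"
    by (subst nn_integral_sum) (auto simp: nn_integral_cmult_indicator)
  also have "\<dots> = (\<integral>\<^sup>+x. 1 - exp_neg (u x) \<partial>\<mu>)"
    by (intro nn_integral_cong rep) auto
  finally show ?thesis .
qed

text \<open>Approximation from below by simple functions to which the previous case applies. On the
  left the integrands decrease but are bounded by 1, so dominated convergence applies; on the right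
  \<open>1 - exp_neg\<close> of the approximants increases, so monotone convergence does.\<close>

theorem (in prob_space) laplace_functional:
  assumes Y: "poisson_process M \<mu> Y" and "sigma_finite_measure \<mu>" and v[measurable]: "v \<in> borel_measurable \<mu>"
  shows "(\<integral>\<^sup>+\<omega>. exp_neg (\<Sum>k. v (Y k \<omega>)) \<partial>M) = exp_neg (\<integral>\<^sup>+x. 1 - exp_neg (v x) \<partial>\<mu>)"
proof -
  interpret \<mu>: sigma_finite_measure \<mu> by fact
  have [measurable]: "\<And>k. Y k \<in> M \<rightarrow>\<^sub>M \<mu>"
    using Y by (auto simp: poisson_process_def)
  have sp: "Y k \<omega> \<in> space \<mu>" if "\<omega> \<in> space M" for k \<omega>
    using that by (meson \<open>\<And>k. Y k \<in> M \<rightarrow>\<^sub>M \<mu>\<close> measurable_space)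
  obtain U where U: "\<And>i. simple_function \<mu> (U i)" "incseq U" "\<And>i x. U i x < top" "\<And>x. (SUP i. U i x) = v x"
    using borel_measurable_implies_simple_function_sequence'[OF v] by metis
  obtain D :: "nat \<Rightarrow> 'b set" where D: "range D \<subseteq> sets \<mu>" "(\<Union>i. D i) = space \<mu>" "\<And>i. emeasure \<mu> (D i) \<noteq> \<infinity>" "incseq D"
    using \<mu>.sigma_finite_incseq by metis
  \<comment> \<open>Cutting the simple functions down to an exhaustion by sets of finite measure
    gives them a support of finite measure.\<close>
  define W where "W i x = U i x * indicator (D i) x" for i x
  have simple: "simple_function \<mu> (W i)" for i
    unfolding W_def using U(1) D(1) by (intro simple_function_mult simple_function_indicator) auto
  have [measurable]: "W i \<in> borel_measurable \<mu>" for i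
    using simple by (rule borel_measurable_simple_function)
  have incW: "incseq (\<lambda>i. W i x)" for x
    unfolding W_def using U(2) D(4)
    by (intro incseq_SucI mult_mono) (auto simp: incseq_Suc_iff le_fun_def indicator_def)
  have limW: "(\<lambda>i. W i x) \<longlonglongrightarrow> v x" if "x \<in> space \<mu>" for x
  proof -
    obtain i0 where i0: "x \<in> D i0" using D(2) \<open>x \<in> space \<mu>\<close> by auto
    have "eventually (\<lambda>i. x \<in> D i) sequentially"
      using eventually_ge_at_top[of i0] by eventually_elim (use i0 D(4) in \<open>auto simp: incseq_def\<close>)
    then have "eventually (\<lambda>i. U i x = W i x) sequentially"
      by eventually_elim (simp add: W_def)
    moreover have "(\<lambda>i. U i x) \<longlonglongrightarrow> v x"
      unfolding U(4)[symmetric] using U(2) by (intro LIMSEQ_SUP) (auto simp: incseq_def le_fun_def)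
    ultimately show ?thesis
      by (rule Lim_transform_eventually[rotated])
  qed
  have sup: "(SUP i. W i x) = v x" if "x \<in> space \<mu>" for x
    using limW[OF that] LIMSEQ_SUP[OF incW] by (rule LIMSEQ_unique[symmetric])
  have lim_sum: "(\<lambda>i. \<Sum>k. W i (Y k \<omega>)) \<longlonglongrightarrow> (\<Sum>k. v (Y k \<omega>))" if "\<omega> \<in> space M" for \<omega>
  proof -
    have "(\<Sum>k. v (Y k \<omega>)) = (SUP i. \<Sum>k. W i (Y k \<omega>))"
      using incW by (simp add: sup[OF sp[OF that], symmetric] ennreal_suminf_SUP_eq)
    then show ?thesis
      using incW by (auto intro!: LIMSEQ_SUP suminf_le simp: incseq_def)
  qed
  have "(\<lambda>i. \<integral>\<^sup>+\<omega>. exp_neg (\<Sum>k. W i (Y k \<omega>)) \<partial>M) \<longlonglongrightarrow> (\<integral>\<^sup>+\<omega>. exp_neg (\<Sum>k. v (Y k \<omega>)) \<partial>M)"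
    by (rule nn_integral_dominated_convergence[where w="\<lambda>_. 1"])
       (auto simp: emeasure_space_1 exp_neg_le_1 intro!: tendsto_exp_neg lim_sum AE_I2)
  moreover have "(\<integral>\<^sup>+\<omega>. exp_neg (\<Sum>k. W i (Y k \<omega>)) \<partial>M) = exp_neg (\<integral>\<^sup>+x. 1 - exp_neg (W i x) \<partial>\<mu>)" for i
  proof (rule laplace_functional_simple[OF Y simple])
    show "W i x < \<infinity>" for x
      using U(3) by (auto simp: W_def indicator_def)
    have "emeasure \<mu> {x \<in> space \<mu>. W i x \<noteq> 0} \<le> emeasure \<mu> (D i)"
      using D(1) by (intro emeasure_mono) (auto simp: W_def indicator_def split: if_splits)
    then show "emeasure \<mu> {x \<in> space \<mu>. W i x \<noteq> 0} < \<infinity>"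
      using D(3)[of i] by (auto simp: less_top[symmetric] top_unique)
  qed
  moreover have "(\<lambda>i. exp_neg (\<integral>\<^sup>+x. 1 - exp_neg (W i x) \<partial>\<mu>)) \<longlonglongrightarrow> exp_neg (\<integral>\<^sup>+x. 1 - exp_neg (v x) \<partial>\<mu>)"
  proof (intro tendsto_exp_neg)
    have "(\<integral>\<^sup>+x. 1 - exp_neg (v x) \<partial>\<mu>) = (\<integral>\<^sup>+x. (SUP i. 1 - exp_neg (W i x)) \<partial>\<mu>)"
    proof (rule nn_integral_cong)
      fix x assume "x \<in> space \<mu>"
      have "(\<lambda>i. 1 - exp_neg (W i x)) \<longlonglongrightarrow> 1 - exp_neg (v x)"
        using limW[OF \<open>x \<in> space \<mu>\<close>] by (intro tendsto_diff_ennreal_general tendsto_const tendsto_exp_neg) auto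
      moreover have "(\<lambda>i. 1 - exp_neg (W i x)) \<longlonglongrightarrow> (SUP i. 1 - exp_neg (W i x))"
        using incW by (intro LIMSEQ_SUP) (auto simp: incseq_def intro!: ennreal_minus_mono exp_neg_antimono)
      ultimately show "1 - exp_neg (v x) = (SUP i. 1 - exp_neg (W i x))"
        by (rule LIMSEQ_unique)
    qed
    also have "\<dots> = (SUP i. \<integral>\<^sup>+x. 1 - exp_neg (W i x) \<partial>\<mu>)"
      using incW by (intro nn_integral_monotone_convergence_SUP)
        (auto simp: incseq_def le_fun_def intro!: ennreal_minus_mono exp_neg_antimono)
    finally show "(\<lambda>i. \<integral>\<^sup>+x. 1 - exp_neg (W i x) \<partial>\<mu>) \<longlonglongrightarrow> (\<integral>\<^sup>+x. 1 - exp_neg (v x) \<partial>\<mu>)"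
      using incW by (auto simp: incseq_def intro!: LIMSEQ_SUP nn_integral_mono ennreal_minus_mono exp_neg_antimono)
  qed
  ultimately show ?thesis
    using LIMSEQ_unique by fastforce
qed

section \<open>Exponential gains\<close>

text \<open>The joint law is the product law because the two agree on rectangles. Independence
  enters through the generated \<sigma>-algebras since gains and positions take values in different
  types; both integrals stay on \<open>M\<close>, so that freezing \<open>Y\<close> means evaluating
  it at a second sample point.\<close>

lemma (in prob_space) indep_set_nn_integral_Fubini:
  assumes X[measurable]: "X \<in> M \<rightarrow>\<^sub>M S" and Y[measurable]: "Y \<in> M \<rightarrow>\<^sub>M T"
    and ind: "indep_set (sets (vimage_algebra (space M) X S)) (sets (vimage_algebra (space M) Y T))"
    and f[measurable]: "f \<in> borel_measurable (S \<Otimes>\<^sub>M T)"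
  shows "(\<integral>\<^sup>+\<omega>. f (X \<omega>, Y \<omega>) \<partial>M) = (\<integral>\<^sup>+\<omega>'. (\<integral>\<^sup>+\<omega>. f (X \<omega>, Y \<omega>') \<partial>M) \<partial>M)"
proof -
  interpret X: prob_space "distr M S X" by (rule prob_space_distr) measurable
  interpret Y: prob_space "distr M T Y" by (rule prob_space_distr) measurable
  interpret pair_sigma_finite "distr M S X" "distr M T Y" ..
  have eq: "distr M S X \<Otimes>\<^sub>M distr M T Y = distr M (S \<Otimes>\<^sub>M T) (\<lambda>x. (X x, Y x))"
  proof (rule pair_measure_eqI)
    fix A B assume AB: "A \<in> sets (distr M S X)" "B \<in> sets (distr M T Y)"
    have "prob ((X -` A \<inter> space M) \<inter> (Y -` B \<inter> space M)) = prob (X -` A \<inter> space M) * prob (Y -` B \<inter> space M)"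
      using AB by (intro indep_setD[OF ind] in_vimage_algebra) auto
    also have "(X -` A \<inter> space M) \<inter> (Y -` B \<inter> space M) = (\<lambda>x. (X x, Y x)) -` (A \<times> B) \<inter> space M"
      by auto
    finally show "emeasure (distr M S X) A * emeasure (distr M T Y) B =
        emeasure (distr M (S \<Otimes>\<^sub>M T) (\<lambda>x. (X x, Y x))) (A \<times> B)"
      using AB by (simp add: emeasure_distr emeasure_eq_measure ennreal_mult)
  qed (auto intro: X.sigma_finite_measure_axioms Y.sigma_finite_measure_axioms cong: sets_pair_measure_cong)
  have "(\<integral>\<^sup>+\<omega>. f (X \<omega>, Y \<omega>) \<partial>M) = (\<integral>\<^sup>+p. f p \<partial>(distr M S X \<Otimes>\<^sub>M distr M T Y))"
    unfolding eq by (subst nn_integral_distr) auto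
  also have "\<dots> = (\<integral>\<^sup>+y. (\<integral>\<^sup>+x. f (x, y) \<partial>distr M S X) \<partial>distr M T Y)"
    by (rule nn_integral_snd[symmetric]) (simp cong: measurable_cong_sets)
  also have "\<dots> = (\<integral>\<^sup>+\<omega>'. (\<integral>\<^sup>+x. f (x, Y \<omega>') \<partial>distr M S X) \<partial>M)"
    by (subst nn_integral_distr) auto
  also have "\<dots> = (\<integral>\<^sup>+\<omega>'. (\<integral>\<^sup>+\<omega>. f (X \<omega>, Y \<omega>') \<partial>M) \<partial>M)"
    by (intro nn_integral_cong, subst nn_integral_distr) (auto dest: measurable_space[OF Y])
  finally show ?thesis .
qed

text \<open>The value is \<open>1 / (1 + a)\<close>. It is kept in logarithmic form so that a
  product over interferers becomes \<open>exp_neg\<close> of a sum, the form required by the Laplace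
  functional.\<close>

lemma (in prob_space) exponential_laplace_transform:
  assumes D: "distributed M lborel X (exponential_density 1)" and a: "a \<ge> 0"
  shows "(\<integral>\<^sup>+\<omega>. exp_neg (ennreal (a * X \<omega>)) \<partial>M) = exp_neg (ennreal (ln (1 + a)))"
proof -
  define k where "k = 1 + a"
  have k: "k > 0"
    using a by (simp add: k_def)
  have "(\<integral>\<^sup>+\<omega>. exp_neg (ennreal (a * X \<omega>)) \<partial>M) =
      (\<integral>\<^sup>+x. ennreal (exponential_density 1 x) * exp_neg (ennreal (a * x)) \<partial>lborel)"
    by (rule distributed_nn_integral[OF D, symmetric]) measurable
  also have "\<dots> = (\<integral>\<^sup>+x. ennreal (exp (- (k * x))) * indicator {0..} x \<partial>lborel)"
    using a by (intro nn_integral_cong)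
      (auto simp: exponential_density_def indicator_def exp_neg_ennreal ennreal_mult[symmetric] k_def ring_distribs simp flip: exp_add)
  also have "\<dots> = ennreal (0 - (- exp (- (k * 0)) / k))"
  proof (rule nn_integral_FTC_atLeast)
    show "((\<lambda>x. - exp (- (k * x)) / k) has_real_derivative exp (- (k * x))) (at x)" for x
      using k by (auto intro!: derivative_eq_intros)
    have "filterlim (\<lambda>x. k * x) at_top at_top"
      using k by (intro filterlim_tendsto_pos_mult_at_top[OF tendsto_const] filterlim_ident) auto
    then have "((\<lambda>x. exp (- (k * x))) \<longlongrightarrow> 0) at_top"
      by (intro filterlim_compose[OF exp_at_bot] filterlim_compose[OF filterlim_uminus_at_bot_at_top])
    then have "((\<lambda>x. - exp (- (k * x)) / k) \<longlongrightarrow> - 0 / k) at_top"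
      using k by (intro tendsto_intros) auto
    then show "((\<lambda>x. - exp (- (k * x)) / k) \<longlongrightarrow> 0) at_top" by simp
  qed auto
  also have "\<dots> = exp_neg (ennreal (ln (1 + a)))"
    using a by (simp add: k_def exp_neg_ennreal exp_minus divide_inverse)
  finally show ?thesis .
qed

lemma (in prob_space) exponential_tail:
  assumes D: "distributed M lborel X (exponential_density 1)"
  shows "emeasure M {\<omega> \<in> space M. t < ennreal (X \<omega>)} = exp_neg t"
proof (cases t)
  case (real c)
  then have "{\<omega> \<in> space M. t < ennreal (X \<omega>)} = {\<omega> \<in> space M. c < X \<omega>}"
    by (auto simp: ennreal_less_iff)
  then show ?thesis
    using exponential_distributedD_gt[OF D, of c] real
    by (simp add: emeasure_eq_measure exp_neg_ennreal)
qed simp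

text \<open>The coefficients \<open>a\<close> are constants: this is the situation with frozen
  positions. The exponential tail of the serving gain is evaluated at an independent random
  threshold, after which the expectation factorises over the interferer gains.\<close>

lemma (in prob_space) exponential_coverage:
  fixes G :: "('i \<times> nat) option \<Rightarrow> 'a \<Rightarrow> real" and I :: "'i set"
  defines "L \<equiv> insert None (Some ` (I \<times> UNIV))"
  assumes D: "\<And>l. l \<in> L \<Longrightarrow> distributed M lborel (G l) (exponential_density 1)"
    and ind: "indep_vars (\<lambda>_. borel) G L" and I: "finite I" and a: "\<And>m k. a m k \<ge> 0"
  shows "emeasure M {\<omega> \<in> space M. c + (\<Sum>m\<in>I. \<Sum>k. ennreal (a m k * G (Some (m, k)) \<omega>)) < ennreal (G None \<omega>)} =
    exp_neg (c + (\<Sum>m\<in>I. \<Sum>k. ennreal (ln (1 + a m k))))"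
proof -
  have G[measurable]: "random_variable borel (G l)" if "l \<in> L" for l
    using D[OF that] by (auto dest: distributed_measurable)
  define T where "T \<omega> = c + (\<Sum>m\<in>I. \<Sum>k. ennreal (a m k * G (Some (m, k)) \<omega>))" for \<omega>
  define \<Phi> where "\<Phi> f = c + (\<Sum>m\<in>I. \<Sum>k. ennreal (a m k * f (Some (m, k))))" for f :: "('i \<times> nat) option \<Rightarrow> real"
  define S where "S = Some ` (I \<times> (UNIV :: nat set))"
  have \<Phi>: "\<Phi> \<in> borel_measurable (PiM S (\<lambda>_. borel))"
    unfolding \<Phi>_def S_def
    by (intro borel_measurable_add borel_measurable_sum borel_measurable_suminf_order borel_measurable_const measurable_compose[OF _ measurable_ennreal]
        borel_measurable_times measurable_component_singleton) auto
  have T[measurable]: "random_variable borel T"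
    unfolding T_def by (intro borel_measurable_add borel_measurable_sum borel_measurable_suminf_order borel_measurable_const measurable_compose[OF _ measurable_ennreal]
        borel_measurable_times G) (auto simp: L_def)
  \<comment> \<open>The serving link and the interferer links are disjoint sets of indices, so the
    serving gain is independent of the threshold \<open>T\<close>.\<close>
  have "indep_var (PiM {None} (\<lambda>_. borel)) (\<lambda>\<omega>. \<lambda>l\<in>{None}. G l \<omega>) (PiM S (\<lambda>_. borel)) (\<lambda>\<omega>. \<lambda>l\<in>S. G l \<omega>)"
    by (rule indep_var_restrict[OF ind]) (auto simp: L_def S_def)
  from indep_var_compose[OF this _ \<Phi>, of "\<lambda>f. ennreal (f None)" borel]
  have "indep_var borel ((\<lambda>f. ennreal (f None)) \<circ> (\<lambda>\<omega>. \<lambda>l\<in>{None}. G l \<omega>)) borel (\<Phi> \<circ> (\<lambda>\<omega>. \<lambda>l\<in>S. G l \<omega>))"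
    by (auto intro!: measurable_component_singleton)
  also have "(\<lambda>f. ennreal (f None)) \<circ> (\<lambda>\<omega>. \<lambda>l\<in>{None}. G l \<omega>) = (\<lambda>\<omega>. ennreal (G None \<omega>))"
    by auto
  also have "\<Phi> \<circ> (\<lambda>\<omega>. \<lambda>l\<in>S. G l \<omega>) = T"
    by (auto simp: \<Phi>_def T_def S_def fun_eq_iff intro!: sum.cong)
  finally have ind2: "indep_var borel (\<lambda>\<omega>. ennreal (G None \<omega>)) borel T" .
  have ind_eq: "emeasure M {\<omega> \<in> space M. t \<omega> < ennreal (G None \<omega>)} =
      (\<integral>\<^sup>+\<omega>. indicator {p. snd p < fst p} (ennreal (G None \<omega>), t \<omega>) \<partial>M)"
    if [measurable]: "random_variable borel t" for t
  proof -
    have [measurable]: "random_variable borel (G None)"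
      by (rule G) (simp add: L_def)
    have "(\<integral>\<^sup>+\<omega>. indicator {p. snd p < fst p} (ennreal (G None \<omega>), t \<omega>) \<partial>M) =
        (\<integral>\<^sup>+\<omega>. indicator {\<omega> \<in> space M. t \<omega> < ennreal (G None \<omega>)} \<omega> \<partial>M)"
      by (intro nn_integral_cong) (auto simp: indicator_def)
    also have "\<dots> = emeasure M {\<omega> \<in> space M. t \<omega> < ennreal (G None \<omega>)}"
      by (rule nn_integral_indicator) measurable
    finally show ?thesis ..
  qed
  have "emeasure M {\<omega> \<in> space M. T \<omega> < ennreal (G None \<omega>)} =
      (\<integral>\<^sup>+\<omega>. indicator {p. snd p < fst p} (ennreal (G None \<omega>), T \<omega>) \<partial>M)"
    by (rule ind_eq) measurable
  also have "\<dots> = (\<integral>\<^sup>+\<omega>'. (\<integral>\<^sup>+\<omega>. indicator {p. snd p < fst p} (ennreal (G None \<omega>), T \<omega>') \<partial>M) \<partial>M)"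
    using ind2 by (intro indep_set_nn_integral_Fubini[where S = borel and T = borel])
      (auto simp: indep_var_eq sets_vimage_algebra)
  also have "\<dots> = (\<integral>\<^sup>+\<omega>'. exp_neg (T \<omega>') \<partial>M)"
    by (intro nn_integral_cong, subst ind_eq[symmetric]) (auto intro!: exponential_tail D simp: L_def)
  also have "\<dots> = exp_neg (c + (\<Sum>m\<in>I. \<Sum>k. ennreal (ln (1 + a m k))))"
  proof (rule LIMSEQ_unique)
    \<comment> \<open>The product formula is applied to finitely many gains at a time, hence each
      series is cut after \<open>K\<close> terms. Both sides are identified as limits of the same
      sequence, with the constant 1 as dominating function.\<close>
    define A where "A K \<omega> = c + (\<Sum>m\<in>I. \<Sum>k<K. ennreal (a m k * G (Some (m, k)) \<omega>))" for K \<omega>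
    have [measurable]: "random_variable borel (A K)" for K
      unfolding A_def by (intro borel_measurable_add borel_measurable_sum borel_measurable_const measurable_compose[OF _ measurable_ennreal]
        borel_measurable_times G) (auto simp: L_def)
    have "(\<lambda>K. A K \<omega>) \<longlonglongrightarrow> T \<omega>" for \<omega>
      unfolding A_def T_def by (intro tendsto_intros summable_LIMSEQ) auto
    then show "(\<lambda>K. \<integral>\<^sup>+\<omega>. exp_neg (A K \<omega>) \<partial>M) \<longlonglongrightarrow> (\<integral>\<^sup>+\<omega>. exp_neg (T \<omega>) \<partial>M)"
      by (intro nn_integral_dominated_convergence[where w="\<lambda>_. 1"])
         (auto simp: emeasure_space_1 exp_neg_le_1 intro!: tendsto_exp_neg AE_I2)
    have "(\<integral>\<^sup>+\<omega>. exp_neg (A K \<omega>) \<partial>M) = exp_neg (c + (\<Sum>m\<in>I. \<Sum>k<K. ennreal (ln (1 + a m k))))" for K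
    proof -
      define b where "b l = (case l of None \<Rightarrow> 0 | Some (m, k) \<Rightarrow> a m k)" for l
      define J where "J = Some ` (I \<times> {..<K})"
      have J: "finite J" "J \<subseteq> L" using I by (auto simp: J_def L_def)
      have reindex: "(\<Sum>m\<in>I. \<Sum>k<K. F (a m k) (Some (m, k))) = (\<Sum>l\<in>J. F (b l) l)" for F :: "real \<Rightarrow> ('i \<times> nat) option \<Rightarrow> ennreal"
        unfolding J_def sum.cartesian_product
        by (subst sum.reindex) (auto simp: b_def o_def case_prod_beta)
      have "(\<integral>\<^sup>+\<omega>. exp_neg (A K \<omega>) \<partial>M) = (\<integral>\<^sup>+\<omega>. exp_neg c * (\<Prod>l\<in>J. exp_neg (ennreal (b l * G l \<omega>))) \<partial>M)"
        unfolding A_def by (simp add: exp_neg_add exp_neg_sum[symmetric] reindex[of "\<lambda>x l. ennreal (x * G l _)"])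
      also have "\<dots> = exp_neg c * (\<integral>\<^sup>+\<omega>. (\<Prod>l\<in>J. exp_neg (ennreal (b l * G l \<omega>))) \<partial>M)"
        unfolding exp_neg_sum[symmetric] using J
        by (intro nn_integral_cmult measurable_compose[OF _ measurable_exp_neg] borel_measurable_sum
          measurable_compose[OF _ measurable_ennreal] borel_measurable_times G) auto
      also have "(\<integral>\<^sup>+\<omega>. (\<Prod>l\<in>J. exp_neg (ennreal (b l * G l \<omega>))) \<partial>M) = (\<Prod>l\<in>J. \<integral>\<^sup>+\<omega>. exp_neg (ennreal (b l * G l \<omega>)) \<partial>M)"
        by (intro indep_vars_nn_integral J indep_vars_compose2[where Y="\<lambda>l x. exp_neg (ennreal (b l * x))", OF indep_vars_subset[OF ind]]) auto
      also have "\<dots> = (\<Prod>l\<in>J. exp_neg (ennreal (ln (1 + b l))))"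
        using J a by (intro prod.cong exponential_laplace_transform D) (auto simp: b_def split: option.split prod.split)
      finally show ?thesis
        by (simp add: exp_neg_add exp_neg_sum[symmetric] reindex[of "\<lambda>x l. ennreal (ln (1 + x))"])
    qed
    moreover have "(\<lambda>K. exp_neg (c + (\<Sum>m\<in>I. \<Sum>k<K. ennreal (ln (1 + a m k))))) \<longlonglongrightarrow>
        exp_neg (c + (\<Sum>m\<in>I. \<Sum>k. ennreal (ln (1 + a m k))))"
      by (intro tendsto_intros summable_LIMSEQ) auto
    ultimately show "(\<lambda>K. \<integral>\<^sup>+\<omega>. exp_neg (A K \<omega>) \<partial>M) \<longlonglongrightarrow> exp_neg (c + (\<Sum>m\<in>I. \<Sum>k. ennreal (ln (1 + a m k))))"
      by simp
  qed
  finally show ?thesis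
    by (simp add: T_def)
qed

section \<open>The Euler integral of the hypergeometric function\<close>

definition slit_plane :: "complex set" where
  "slit_plane = - (of_real ` {1::real..})"

text \<open>
  The Euler integral \<open>b \<integral> t powr (b - 1) / (1 - z t) dt\<close> over the unit interval, after the substitution
  \<open>u = t powr b\<close>, \<open>c = 1 / b\<close>, which makes the integrand continuous.
\<close>

definition hypergeo_integral :: "real \<Rightarrow> complex \<Rightarrow> complex" where
  "hypergeo_integral c z = integral {0..1} (\<lambda>u. 1 / (1 - z * of_real (u powr c)))"

lemma slit_plane_altdef: "slit_plane = - ({z. Im z = 0} \<inter> {z. Re z \<ge> 1})"
proof -
  have "z \<in> of_real ` {1..}" if "Im z = 0" "Re z \<ge> 1" for z
    using that by (intro image_eqI[of _ _ "Re z"]) (auto simp: complex_eq_iff)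
  then show ?thesis by (auto simp: slit_plane_def)
qed

lemma open_slit_plane: "open slit_plane"
  unfolding slit_plane_altdef
  by (intro open_Compl closed_Int closed_Collect_eq closed_Collect_le continuous_intros)

text \<open>The set is star-shaped about 0: if \<open>t * w\<close> with \<open>t\<close> in the
  unit interval were a real number at least 1, so would be \<open>w\<close>. Connectedness is what
  makes the analytic continuation unique.\<close>

lemma connected_slit_plane: "connected slit_plane"
proof (intro starlike_imp_connected)
  have "z \<in> slit_plane" if "z \<in> closed_segment 0 w" "w \<in> slit_plane" for z w
  proof -
    obtain t where t: "z = t *\<^sub>R w" "0 \<le> t" "t \<le> 1"
      using \<open>z \<in> closed_segment 0 w\<close> by (auto simp: in_segment)
    have "Re w \<ge> 1" if "t * Re w \<ge> 1"
      using that t mult_left_le_one_le[of "Re w" t] mult_nonneg_nonpos[of t "Re w"]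
      by (cases "Re w \<ge> 0") auto
    moreover have "t \<noteq> 0" if "t * Re w \<ge> 1"
      using that by auto
    ultimately show ?thesis
      using \<open>w \<in> slit_plane\<close> t by (auto simp: slit_plane_altdef)
  qed
  then show "starlike slit_plane"
    unfolding starlike_def by (intro bexI[of _ 0]) (auto simp: slit_plane_altdef)
qed

lemma one_minus_mult_neq_0:
  assumes "z \<in> slit_plane" "0 \<le> r" "r \<le> 1"
  shows "1 - z * of_real r \<noteq> 0"
proof
  assume "1 - z * of_real r = 0"
  then have eq: "z * of_real r = 1" by simp
  then have "r \<noteq> 0" by auto
  then have "z = of_real (1 / r)"
    using eq by (simp add: field_simps)
  then show False
    using assms \<open>r \<noteq> 0\<close> by (auto simp del: of_real_divide simp: slit_plane_def)
qed

text \<open>Differentiation under the integral sign, carried out on balls because it is applied on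
  convex sets and the slit plane is not convex. The exponent \<open>c > 0\<close> makes
  \<open>u powr c\<close> continuous up to \<open>u = 0\<close>.\<close>

lemma hypergeo_integral_holomorphic:
  assumes c: "c > 0"
  shows "hypergeo_integral c holomorphic_on slit_plane"
  unfolding holomorphic_on_def
proof
  fix w assume "w \<in> slit_plane"
  then obtain e where e: "e > 0" "ball w e \<subseteq> slit_plane"
    using open_slit_plane openE by blast
  have nz: "1 - z * of_real (u powr c) \<noteq> 0" if "z \<in> ball w e" "u \<in> {0..1}" for z u
    using that e c by (intro one_minus_mult_neq_0) (auto intro!: powr_le1)
  have "(\<lambda>z. integral (cbox 0 1) (\<lambda>u. 1 / (1 - z * of_real (u powr c)))) holomorphic_on ball w e"
  proof (rule leibniz_rule_holomorphic)
    fix z and u :: real assume z: "z \<in> ball w e" and "u \<in> cbox 0 1"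
    then have "1 - z * of_real (u powr c) \<noteq> 0" by (intro nz) auto
    then show "((\<lambda>z. 1 / (1 - z * of_real (u powr c))) has_field_derivative
        of_real (u powr c) / (1 - z * of_real (u powr c))\<^sup>2) (at z within ball w e)"
      by (auto intro!: derivative_eq_intros simp: power2_eq_square)
  next
    fix z assume "z \<in> ball w e"
    then show "(\<lambda>u. 1 / (1 - z * of_real (u powr c))) integrable_on cbox 0 1"
      using nz c by (intro integrable_continuous continuous_intros continuous_on_powr') auto
  next
    show "continuous_on (ball w e \<times> cbox 0 1) (\<lambda>(z, u). of_real (u powr c) / (1 - z * of_real (u powr c))\<^sup>2)"
      unfolding case_prod_beta using nz c
      by (intro continuous_intros continuous_on_powr') auto
  qed auto
  then have "hypergeo_integral c holomorphic_on ball w e"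
    by (simp add: hypergeo_integral_def[abs_def] cbox_interval)
  then show "hypergeo_integral c field_differentiable at w within slit_plane"
    using e by (metis centre_in_ball field_differentiable_at_within holomorphic_on_imp_differentiable_at open_ball)
qed

text \<open>The integrand is a geometric series dominated by the powers of \<open>norm z\<close>, so
  it may be integrated term by term. The \<open>i\<close>-th term gives the coefficient
  \<open>b / (b + i)\<close>, which is the quotient of the Pochhammer symbols of \<open>b\<close>
  and \<open>b + 1\<close>; that of 1 cancels the factorial.\<close>

lemma hypergeo_integral_eq_series:
  assumes b: "b > 0" and z: "norm z < 1"
  shows "hypergeo_integral (1 / b) z = eval_fps (fps_hypergeo [1, of_real b] [of_real (b + 1)] 1) z"
proof -
  define r where "r u = complex_of_real (u powr (1 / b))" for u
  have r: "norm (r u) \<le> 1" if "u \<in> {0..1}" for u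
    using that b by (auto simp: r_def powr_le1)
  have cont: "continuous_on {0..1} r"
    unfolding r_def using b by (intro continuous_intros continuous_on_powr') auto
  have zr: "norm (z * r u) < 1" if "u \<in> {0..1}" for u
    using mult_left_mono[OF r[OF that], of "norm z"] z by (simp add: norm_mult)
  have "uniform_limit {0..1} (\<lambda>n u. \<Sum>i<n. (z * r u) ^ i) (\<lambda>u. \<Sum>i. (z * r u) ^ i) sequentially"
  proof (rule Weierstrass_m_test)
    show "norm ((z * r u) ^ n) \<le> norm z ^ n" if "u \<in> {0..1}" for n u
      using r[OF that] by (auto simp: norm_power norm_mult intro!: power_mono mult_left_le)
  qed (use z in auto)
  moreover have "continuous_on {0..1} (\<lambda>u. \<Sum>i<n. (z * r u) ^ i)" for n
    using cont by (intro continuous_intros)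
  ultimately obtain I J where IJ: "\<And>n. ((\<lambda>u. \<Sum>i<n. (z * r u) ^ i) has_integral I n) {0..1}"
      "((\<lambda>u. \<Sum>i. (z * r u) ^ i) has_integral J) {0..1}" "I \<longlonglongrightarrow> J"
    using uniform_limit_integral[where a = 0 and b = 1 and f = "\<lambda>n u. \<Sum>i<n. (z * r u) ^ i"
        and g = "\<lambda>u. \<Sum>i. (z * r u) ^ i" and F = sequentially] by (metis trivial_limit_sequentially)
  have lim: "(\<lambda>n. integral {0..1} (\<lambda>u. \<Sum>i<n. (z * r u) ^ i)) \<longlonglongrightarrow> integral {0..1} (\<lambda>u. \<Sum>i. (z * r u) ^ i)"
    unfolding IJ(1)[THEN integral_unique] IJ(2)[THEN integral_unique] by (rule IJ(3))
  have J: "integral {0..1} (\<lambda>u. \<Sum>i. (z * r u) ^ i) = hypergeo_integral (1 / b) z"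
    unfolding hypergeo_integral_def
  proof (rule integral_cong)
    fix u :: real assume "u \<in> {0..1}"
    from suminf_geometric[OF zr[OF this]] show "(\<Sum>i. (z * r u) ^ i) = 1 / (1 - z * of_real (u powr (1 / b)))"
      by (simp only: r_def)
  qed
  have S: "(\<lambda>n. integral {0..1} (\<lambda>u. \<Sum>i<n. (z * r u) ^ i)) =
      (\<lambda>n. \<Sum>i<n. fps_hypergeo [1, of_real b] [of_real (b + 1)] 1 $ i * z ^ i)"
  proof
    fix n
    have int: "((\<lambda>u. (z * r u) ^ i) has_integral fps_hypergeo [1, of_real b] [of_real (b + 1)] 1 $ i * z ^ i) {0..1}" for i
    proof -
      have "((\<lambda>u. u powr (real i / b)) has_integral 1 powr (real i / b + 1) / (real i / b + 1)) {0..1}"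
        using b divide_nonneg_pos[of "real i" b] by (intro has_integral_powr_from_0) linarith+
      then have "((\<lambda>u. z ^ i * of_real (u powr (real i / b))) has_integral z ^ i * of_real (1 / (real i / b + 1))) {0..1}"
        by (intro has_integral_mult_right has_integral_of_real) simp
      \<comment> \<open>The point 0 is excepted: for \<open>i = 0\<close> the power there is 1,
        whereas \<open>0 powr 0 = 0\<close>.\<close>
      then have "((\<lambda>u. (z * r u) ^ i) has_integral z ^ i * of_real (1 / (real i / b + 1))) {0..1}"
        by (rule has_integral_spike_finite[rotated 2, of _ _ _ "{0}"])
           (auto simp: r_def power_mult_distrib powr_powr powr_realpow[symmetric] simp flip: of_real_power)
      also have "of_real (1 / (real i / b + 1)) = fps_hypergeo [1, of_real b :: complex] [of_real (b + 1)] 1 $ i"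
      proof -
        \<comment> \<open>Both sides are the Pochhammer symbol of \<open>b\<close> of order
          \<open>i + 1\<close>, split at its first and at its last factor.\<close>
        have p: "b * pochhammer (b + 1) i = pochhammer b i * (b + real i)"
          using pochhammer_rec[of b i] pochhammer_rec'[of b i] by (simp add: mult.commute)
        have "pochhammer (b + 1) i \<noteq> 0"
          using b pochhammer_pos[of "b + 1" i] by simp
        then have "1 / (real i / b + 1) = fact i * pochhammer b i / (pochhammer (b + 1) i * fact i)"
          using p b by (simp add: field_simps)
        then have "complex_of_real (1 / (real i / b + 1)) = of_real (fact i * pochhammer b i / (pochhammer (b + 1) i * fact i))"
          by simp
        then show ?thesis
          by (simp add: pochhammer_fact[symmetric] pochhammer_of_real[symmetric])
      qed
      finally show ?thesis by (simp add: mult.commute)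
    qed
    show "integral {0..1} (\<lambda>u. \<Sum>i<n. (z * r u) ^ i) =
        (\<Sum>i<n. fps_hypergeo [1, of_real b] [of_real (b + 1)] 1 $ i * z ^ i)"
      by (intro integral_unique has_integral_sum int) auto
  qed
  show ?thesis
    using lim unfolding J S eval_fps_def by (simp only: sums_def[symmetric] sums_iff)
qed

text \<open>The integral shows that the choice in \<open>hyp2F1\<close> is from a nonempty set, and
  the identity theorem, started from the unit disc, shows that every possible choice agrees with it
  on the slit plane.\<close>

lemma hyp2F1_eq_integral:
  assumes b: "b > 0" and z: "z \<in> slit_plane"
  shows "hyp2F1 1 (of_real b) (of_real (b + 1)) z = hypergeo_integral (1 / b) z"
proof -
  define P where "P F \<longleftrightarrow> F holomorphic_on slit_plane \<and>
    (\<forall>z. norm z < 1 \<longrightarrow> F z = eval_fps (fps_hypergeo [1, of_real b] [of_real (b + 1)] 1) z)" for F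
  have "P (hypergeo_integral (1 / b))"
    using b by (auto simp: P_def hypergeo_integral_holomorphic hypergeo_integral_eq_series)
  then have "P (SOME F. P F)"
    by (rule someI[of P])
  then have F: "P (hyp2F1 1 (of_real b) (of_real (b + 1)))"
    by (simp add: hyp2F1_def P_def slit_plane_def)
  have "ball 0 1 \<subseteq> slit_plane"
  proof
    fix w :: complex assume "w \<in> ball 0 1"
    then have "Re w < 1"
      using complex_Re_le_cmod[of w] by simp
    then show "w \<in> slit_plane"
      by (simp add: slit_plane_altdef)
  qed
  with F \<open>P (hypergeo_integral (1 / b))\<close> have "hyp2F1 1 (of_real b) (of_real (b + 1)) w = hypergeo_integral (1 / b) w" if "w \<in> ball 0 1" for w
    using that unfolding P_def by simp
  with F \<open>P (hypergeo_integral (1 / b))\<close> show ?thesis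
    unfolding P_def using analytic_continuation_open[OF open_ball open_slit_plane _ connected_slit_plane \<open>ball 0 1 \<subseteq> slit_plane\<close> _ _ _ z]
    by (metis (no_types, lifting) centre_in_ball empty_iff zero_less_one)
qed

lemma real_hyp2F1_eq_integral:
  assumes b: "b > 0" and s: "s \<ge> 0"
  shows "real_hyp2F1 1 b (b + 1) (- s) = integral {0..1} (\<lambda>u. 1 / (1 + s * u powr (1 / b)))"
proof -
  have nz: "1 + s * u powr (1 / b) \<noteq> 0" if "u \<in> {0..1}" for u
    using s by (smt (verit) mult_nonneg_nonneg powr_ge_zero)
  have "(\<lambda>u. 1 / (1 + s * u powr (1 / b))) integrable_on {0..1}"
    using b nz by (intro integrable_continuous_interval continuous_intros continuous_on_powr') auto
  then have "((\<lambda>u. complex_of_real (1 / (1 + s * u powr (1 / b)))) has_integral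
      of_real (integral {0..1} (\<lambda>u. 1 / (1 + s * u powr (1 / b))))) {0..1}"
    by (intro has_integral_of_real integrable_integral)
  then have "hypergeo_integral (1 / b) (of_real (- s)) = of_real (integral {0..1} (\<lambda>u. 1 / (1 + s * u powr (1 / b))))"
    by (simp add: hypergeo_integral_def integral_unique)
  then show ?thesis
    using hyp2F1_eq_integral[OF b, of "of_real (- s)"] s
    by (simp add: real_hyp2F1_def slit_plane_altdef)
qed

section \<open>Path loss integrals in the plane\<close>

text \<open>Polar coordinates for radial functions, obtained from disc areas alone: both measures
  give \<open>{..a}\<close> the mass \<pi> times \<open>a\<close> squared for
  \<open>a \<ge> 0\<close>, and such half-lines form an intersection-stable generator. For negative
  \<open>r\<close> the function \<open>ennreal\<close> makes the density 0.\<close>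

lemma distr_norm_plane:
  "distr lborel borel (norm :: real ^ 2 \<Rightarrow> real) = density lborel (\<lambda>r. ennreal (2 * pi * r))"
proof (rule measure_eqI_generator_eq[where E = "range atMost" and \<Omega> = UNIV and A = "\<lambda>n. {..real n}"])
  have *: "emeasure (distr lborel borel (norm :: real ^ 2 \<Rightarrow> real)) {..a} = ennreal (if a \<ge> 0 then pi * a\<^sup>2 else 0)" for a
  proof -
    have "emeasure (distr lborel borel (norm :: real ^ 2 \<Rightarrow> real)) {..a} = emeasure lborel (cball (0 :: real ^ 2) a)"
      by (subst emeasure_distr) (auto intro!: arg_cong2[where f = emeasure])
    also have "\<dots> = ennreal (if a \<ge> 0 then pi * a\<^sup>2 else 0)"
      by (simp add: emeasure_cball unit_ball_vol_2)
    finally show ?thesis .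
  qed
  have **: "emeasure (density lborel (\<lambda>r. ennreal (2 * pi * r))) {..a} = ennreal (if a \<ge> 0 then pi * a\<^sup>2 else 0)" for a
  proof -
    have "emeasure (density lborel (\<lambda>r. ennreal (2 * pi * r))) {..a} =
        (\<integral>\<^sup>+r. ennreal (2 * pi * r) * indicator {0..a} r \<partial>lborel)"
      by (subst emeasure_density) (auto intro!: nn_integral_cong simp: indicator_def ennreal_neg mult_nonneg_nonpos)
    also have "\<dots> = ennreal (if a \<ge> 0 then pi * a\<^sup>2 else 0)"
    proof (cases "a \<ge> 0")
      case True
      have "(\<integral>\<^sup>+r. ennreal (2 * pi * r) * indicator {0..a} r \<partial>lborel) = ennreal (pi * a\<^sup>2 - pi * 0\<^sup>2)"
        using True by (intro nn_integral_FTC_Icc[where F = "\<lambda>r. pi * r\<^sup>2"])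
          (auto intro!: derivative_eq_intros)
      then show ?thesis using True by simp
    qed auto
    finally show ?thesis .
  qed
  show "emeasure (distr lborel borel (norm :: real ^ 2 \<Rightarrow> real)) X = emeasure (density lborel (\<lambda>r. ennreal (2 * pi * r))) X"
    if "X \<in> range atMost" for X
    using that * ** by auto
  show "emeasure (distr lborel borel (norm :: real ^ 2 \<Rightarrow> real)) {..real n} \<noteq> \<infinity>" for n
    by (simp add: *)
  show "(\<Union>n. {..real n}) = UNIV"
    using real_arch_simple by auto
  show "Int_stable (range atMost :: real set set)"
    by (auto simp: Int_stable_def)
  have "sets (borel :: real measure) = sigma_sets UNIV (range atMost)"
    by (subst borel_eq_atMost) auto
  then show "sets (distr lborel borel (norm :: real ^ 2 \<Rightarrow> real)) = sigma_sets UNIV (range atMost)"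
    "sets (density lborel (\<lambda>r. ennreal (2 * pi * r))) = sigma_sets UNIV (range atMost)"
    by auto
qed auto

lemma nn_integral_radial:
  assumes [measurable]: "\<phi> \<in> borel_measurable borel"
  shows "(\<integral>\<^sup>+y. \<phi> (norm (y :: real ^ 2)) \<partial>lborel) = (\<integral>\<^sup>+r. ennreal (2 * pi * r) * \<phi> r \<partial>lborel)"
proof -
  have "(\<integral>\<^sup>+y. \<phi> (norm (y :: real ^ 2)) \<partial>lborel) = (\<integral>\<^sup>+r. \<phi> r \<partial>distr lborel borel (norm :: real ^ 2 \<Rightarrow> real))"
    by (subst nn_integral_distr) auto
  then show ?thesis
    by (simp add: distr_norm_plane nn_integral_density)
qed

lemma continuous_on_Z1_integrand:
  assumes c: "c > 0" and s: "s \<ge> 0"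
  shows "continuous_on {0..a} (\<lambda>u. 1 / (1 + s * u powr c :: real))"
proof -
  have "1 + s * u powr c > 0" for u
    using s by (intro add_pos_nonneg) auto
  then show ?thesis
    using c by (intro continuous_intros continuous_on_powr') (auto simp: less_imp_neq[symmetric])
qed

lemma Z1_eq_integral:
  assumes "\<beta> > 2" "s \<ge> 0"
  shows "Z1 \<beta> s = 2 * s / (\<beta> - 2) * integral {0..1} (\<lambda>u. 1 / (1 + s * u powr (\<beta> / (\<beta> - 2))))"
proof -
  \<comment> \<open>The parameters of \<open>Z1\<close> are of the form 1, \<open>b\<close>,
    \<open>b + 1\<close> with \<open>b = 1 - 2 / \<beta>\<close>, and \<open>1 / b\<close> is the
    exponent in the integral.\<close>
  have b: "1 - 2 / \<beta> > 0" "2 - 2 / \<beta> = (1 - 2 / \<beta>) + 1" "1 / (1 - 2 / \<beta>) = \<beta> / (\<beta> - 2)"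
    using \<open>\<beta> > 2\<close> by (auto simp: field_simps)
  show ?thesis
    unfolding Z1_def b(2) real_hyp2F1_eq_integral[OF b(1) \<open>s \<ge> 0\<close>] b(3) ..
qed

lemma Z1_nonneg:
  assumes "\<beta> > 2" "s \<ge> 0"
  shows "Z1 \<beta> s \<ge> 0"
  unfolding Z1_eq_integral[OF assms] using assms
  by (intro mult_nonneg_nonneg integral_nonneg integrable_continuous_interval continuous_on_Z1_integrand)
     (auto intro!: divide_nonneg_nonneg add_nonneg_nonneg)

text \<open>In polar coordinates the numerator is a multiple of \<open>r powr (1 - \<beta>)\<close>.
  The power \<open>\<beta> - 2\<close> in \<open>w\<close> makes its derivative such a multiple, and
  \<open>c\<close> is chosen so that \<open>s * w r powr c = q * r powr (- \<beta>)\<close>, with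
  \<open>s\<close> the value of the right-hand side on the circle of radius
  \<open>d\<close>.\<close>

lemma nn_integral_path_loss_tail:
  assumes \<beta>: "\<beta> > 2" and q: "q \<ge> 0" and d: "d > 0"
  shows "(\<integral>\<^sup>+y. ennreal (q * norm (y :: real ^ 2) powr (- \<beta>) / (1 + q * norm y powr (- \<beta>))) *
      indicator {y. norm y \<ge> d} y \<partial>lborel) = ennreal (pi * d\<^sup>2 * Z1 \<beta> (q * d powr (- \<beta>)))"
proof -
  define s where "s = q * d powr (- \<beta>)"
  define c where "c = \<beta> / (\<beta> - 2)"
  \<comment> \<open>The antiderivative of \<open>f\<close> is \<open>- K * H (w r)\<close>, by the substitution \<open>u = w r\<close>.\<close>
  define H where "H w = integral {0..w} (\<lambda>u. 1 / (1 + s * u powr c))" for w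
  define K where "K = 2 * pi * d\<^sup>2 * s / (\<beta> - 2)"
  define w where "w r = (d / r) powr (\<beta> - 2)" for r
  define f where "f r = 2 * pi * r * (q * r powr (- \<beta>) / (1 + q * r powr (- \<beta>)))" for r
  have s: "s \<ge> 0" and c: "c > 0"
    using q \<beta> by (auto simp: s_def c_def)
  have pos: "1 + s * u powr c > 0" for u
    using s by (intro add_pos_nonneg) auto
  \<comment> \<open>The interval extends beyond 1 so that \<open>H\<close> has a two-sided
    derivative at 1, the value of \<open>w\<close> at the boundary \<open>r = d\<close>.\<close>
  have cont: "continuous_on {0..2} (\<lambda>u. 1 / (1 + s * u powr c))"
    using c s by (rule continuous_on_Z1_integrand)
  have H': "(H has_real_derivative 1 / (1 + s * x powr c)) (at x)" if "0 < x" "x < 2" for x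
    using integral_has_real_derivative[OF cont, of x] that
    by (simp add: H_def[abs_def] at_within_Icc_at)
  have w': "(w has_real_derivative d powr (\<beta> - 2) * ((2 - \<beta>) * r powr (1 - \<beta>))) (at r)" if "r > 0" for r
  proof (rule DERIV_cong_ev[THEN iffD1, OF refl _ refl])
    show "((\<lambda>r. d powr (\<beta> - 2) * r powr (2 - \<beta>)) has_real_derivative d powr (\<beta> - 2) * ((2 - \<beta>) * r powr (1 - \<beta>))) (at r)"
      using that by (auto intro!: derivative_eq_intros)
    show "eventually (\<lambda>r. d powr (\<beta> - 2) * r powr (2 - \<beta>) = w r) (nhds r)"
      using eventually_nhds_in_open[of "{0<..}" r] that
      by (auto elim!: eventually_mono simp: w_def powr_divide powr_diff field_simps d less_imp_le)
  qed
  have w01: "0 < w r \<and> w r \<le> 1" if "r \<ge> d" for r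
    using that d \<beta> by (auto simp: w_def intro!: powr_le1)
  have F': "((\<lambda>r. - K * H (w r)) has_real_derivative f r) (at r)" if r: "r \<ge> d" for r
  proof -
    have "r > 0" using r d by simp
    have "w r powr c = (d / r) powr \<beta>"
      using \<beta> by (simp add: w_def c_def powr_powr)
    then have sw: "s * w r powr c = q * r powr (- \<beta>)"
      using d \<open>r > 0\<close> by (simp add: s_def powr_divide powr_minus field_simps)
    have "((\<lambda>r. H (w r)) has_real_derivative 1 / (1 + s * w r powr c) * (d powr (\<beta> - 2) * ((2 - \<beta>) * r powr (1 - \<beta>)))) (at r)"
      using w01[OF r] by (intro DERIV_chain2[OF H' w'] \<open>r > 0\<close>) auto
    then have "((\<lambda>r. - K * H (w r)) has_real_derivative
        - K * (1 / (1 + s * w r powr c) * (d powr (\<beta> - 2) * ((2 - \<beta>) * r powr (1 - \<beta>))))) (at r)"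
      by (intro DERIV_cmult)
    also have "- K * (1 / (1 + s * w r powr c) * (d powr (\<beta> - 2) * ((2 - \<beta>) * r powr (1 - \<beta>)))) =
       2 * pi * (d\<^sup>2 * d powr (\<beta> - 2) * d powr (- \<beta>)) * q * r powr (1 - \<beta>) / (1 + s * w r powr c)"
    proof -
      have *: "- K * (1 / D * (A * ((2 - \<beta>) * R))) = K * (\<beta> - 2) * A * R / D" for A R D
        by (simp add: divide_inverse algebra_simps)
      have "K * (\<beta> - 2) = 2 * pi * d\<^sup>2 * q * d powr (- \<beta>)"
        using \<beta> by (simp add: K_def s_def)
      then show ?thesis unfolding * by (simp only: mult_ac)
    qed
    also have "d\<^sup>2 * d powr (\<beta> - 2) * d powr (- \<beta>) = 1"
      using d by (simp flip: powr_add powr_numeral)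
    also have "2 * pi * 1 * q * r powr (1 - \<beta>) / (1 + s * w r powr c) = f r"
      unfolding sw f_def using \<open>r > 0\<close> by (simp add: powr_diff powr_minus field_simps)
    finally show ?thesis .
  qed
  have H_bounds: "0 \<le> H x \<and> H x \<le> x" if "0 \<le> x" "x \<le> 1" for x
  proof -
    have int: "(\<lambda>u. 1 / (1 + s * u powr c)) integrable_on {0..x}"
      using that by (intro integrable_continuous_interval continuous_on_subset[OF cont]) auto
    have "H x \<le> integral {0..x} (\<lambda>u. 1)"
      unfolding H_def using s by (intro integral_le int) (auto simp: divide_le_eq add_pos_nonneg)
    moreover have "0 \<le> H x"
      unfolding H_def using pos by (intro integral_nonneg int) (auto simp: less_imp_le)
    ultimately show ?thesis using that by simp
  qed
  \<comment> \<open>The integrand of \<open>H\<close> lies between 0 and 1, so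
    \<open>H (w r)\<close> lies between 0 and \<open>w r\<close>, and \<open>w r\<close> vanishes at
    infinity because \<beta> > 2.\<close>
  have "((\<lambda>r. H (w r)) \<longlongrightarrow> 0) at_top"
  proof (rule tendsto_sandwich[of "\<lambda>_. 0" _ _ w])
    have "((\<lambda>r. d powr (\<beta> - 2) * r powr (- (\<beta> - 2))) \<longlongrightarrow> 0) at_top"
      using \<beta> by (intro tendsto_mult_right_zero tendsto_neg_powr filterlim_ident) auto
    moreover have "eventually (\<lambda>r. d powr (\<beta> - 2) * r powr (- (\<beta> - 2)) = w r) at_top"
      using eventually_gt_at_top[of 0]
      by eventually_elim (use d in \<open>simp only: w_def powr_divide powr_minus_divide less_imp_le, simp\<close>)
    ultimately show "(w \<longlongrightarrow> 0) at_top"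
      by (rule Lim_transform_eventually)
    have "0 \<le> H (w r) \<and> H (w r) \<le> w r" if "r \<ge> d" for r
      using w01[OF that] by (intro H_bounds) auto
    then have "eventually (\<lambda>r. 0 \<le> H (w r) \<and> H (w r) \<le> w r) at_top"
      unfolding eventually_at_top_linorder by blast
    then show "eventually (\<lambda>r. 0 \<le> H (w r)) at_top" "eventually (\<lambda>r. H (w r) \<le> w r) at_top"
      by (simp_all add: eventually_conj_iff)
  qed auto
  then have lim: "((\<lambda>r. - K * H (w r)) \<longlongrightarrow> 0) at_top"
    by (auto intro!: tendsto_eq_intros)
  have "(\<integral>\<^sup>+y. ennreal (q * norm (y :: real ^ 2) powr (- \<beta>) / (1 + q * norm y powr (- \<beta>))) *
      indicator {y. norm y \<ge> d} y \<partial>lborel) =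
     (\<integral>\<^sup>+y. (\<lambda>r. ennreal (q * r powr (- \<beta>) / (1 + q * r powr (- \<beta>))) * indicator {d..} r) (norm (y :: real ^ 2)) \<partial>lborel)"
    by (intro nn_integral_cong) (auto simp: indicator_def)
  also have "\<dots> = (\<integral>\<^sup>+r. ennreal (2 * pi * r) * (ennreal (q * r powr (- \<beta>) / (1 + q * r powr (- \<beta>))) * indicator {d..} r) \<partial>lborel)"
    by (rule nn_integral_radial) measurable
  also have "\<dots> = (\<integral>\<^sup>+r. ennreal (f r) * indicator {d..} r \<partial>lborel)"
    using d q by (intro nn_integral_cong) (auto simp: f_def indicator_def ennreal_mult[symmetric])
  also have "\<dots> = ennreal (0 - (- K * H (w d)))"
    using d q by (intro nn_integral_FTC_atLeast F' lim) (auto simp: f_def)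
  also have "0 - (- K * H (w d)) = pi * d\<^sup>2 * Z1 \<beta> s"
    using d by (simp add: Z1_eq_integral[OF \<beta> s] K_def w_def H_def c_def)
  finally show ?thesis
    by (simp add: s_def)
qed

section \<open>The integral over the whole plane and the limit \<open>Z2\<close>\<close>

lemma Z2_approx_eq_Z1: "a > 0 \<Longrightarrow> \<beta> > 2 \<Longrightarrow> Z2_approx \<beta> \<tau> a = \<tau> powr (2 / \<beta>) * a * Z1 \<beta> (a powr (- \<beta> / 2))"
proof -
  assume "a > 0" "\<beta> > 2"
  \<comment> \<open>Splitting off one factor \<open>a\<close> leaves the prefactor equal to the
    hypergeometric argument up to sign, as in \<open>Z1\<close>.\<close>
  have "(2 - \<beta>) / 2 = 1 + - \<beta> / 2"
    by (simp add: diff_divide_distrib)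
  then have "a powr ((2 - \<beta>) / 2) = a * a powr (- \<beta> / 2)"
    using \<open>a > 0\<close> by (simp only: powr_add powr_one less_imp_le)
  then show ?thesis
    by (simp add: Z2_approx_def Z1_def)
qed

text \<open>The integral over the plane is finite, by comparison with the tail outside the unit
  disc, and it exceeds the tail outside radius \<open>d\<close> by at most the area of the disc. The
  approximants of \<open>Z2\<close> are such tails up to the constant \<open>k\<close>, so this
  bound proves convergence and identifies the limit at once.\<close>

lemma nn_integral_path_loss_plane:
  assumes \<beta>: "\<beta> > 2" and q: "q > 0" and \<tau>: "\<tau> > 0"
  shows "(Z2_approx \<beta> \<tau> \<longlongrightarrow> Z2 \<beta> \<tau>) (at_right 0)" (is ?lim)
    and "(\<integral>\<^sup>+y. ennreal (q * norm (y :: real ^ 2) powr (- \<beta>) / (1 + q * norm y powr (- \<beta>))) \<partial>lborel) =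
      ennreal (pi * (q / \<tau>) powr (2 / \<beta>) * Z2 \<beta> \<tau>)" (is ?int)
proof -
  define \<phi> where "\<phi> y = ennreal (q * norm y powr (- \<beta>) / (1 + q * norm y powr (- \<beta>)))" for y :: "real ^ 2"
  have [measurable]: "\<phi> \<in> borel_measurable borel"
    unfolding \<phi>_def by measurable
  define J where "J d = (\<integral>\<^sup>+y. \<phi> y * indicator {y. norm y \<ge> d} y \<partial>lborel)" for d
  define J0 where "J0 = (\<integral>\<^sup>+y. \<phi> y \<partial>lborel)"
  have upper: "J0 \<le> J d + ennreal (pi * d\<^sup>2)" and lower: "J d \<le> J0" if "d > 0" for d
  proof -
    have "\<phi> y \<le> 1" for y
      using q by (simp add: \<phi>_def divide_le_eq add_pos_nonneg)
    then have "J0 \<le> (\<integral>\<^sup>+y. \<phi> y * indicator {y. norm y \<ge> d} y + indicator (ball 0 d) y \<partial>lborel)"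
      unfolding J0_def by (intro nn_integral_mono) (auto simp: indicator_def)
    also have "\<dots> = J d + emeasure lborel (ball (0 :: real ^ 2) d)"
    proof -
      have "indicator (ball 0 d) \<in> borel_measurable (borel :: (real ^ 2) measure)"
        by (intro borel_measurable_indicator) auto
      then show ?thesis
        unfolding J_def by (subst nn_integral_add) simp_all
    qed
    finally show "J0 \<le> J d + ennreal (pi * d\<^sup>2)"
      using that by (simp add: emeasure_ball unit_ball_vol_2)
    show "J d \<le> J0"
      unfolding J_def J0_def by (intro nn_integral_mono) (auto simp: indicator_def)
  qed
  have J_tail: "J d = ennreal (pi * d\<^sup>2 * Z1 \<beta> (q * d powr (- \<beta>)))" if "d > 0" for d
    unfolding J_def \<phi>_def using \<beta> q that by (intro nn_integral_path_loss_tail) auto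
  have "J0 < \<infinity>"
    using upper[of 1] by (auto simp: J_tail ennreal_add_eq_top less_top[symmetric] top_unique)
  then obtain j where j: "J0 = ennreal j" "j \<ge> 0"
    by (cases J0) auto
  define k where "k = pi * (q / \<tau>) powr (2 / \<beta>)"
  have k: "k > 0" using q \<tau> by (simp add: k_def)
  have bound: "\<bar>k * Z2_approx \<beta> \<tau> a - j\<bar> \<le> pi * q powr (2 / \<beta>) * a" if a: "a > 0" for a
  proof -
    \<comment> \<open>Chosen so that \<open>q * d powr (- \<beta>) = a powr (- \<beta> / 2)\<close>.
      The area of the disc of radius \<open>d\<close> is then proportional to \<open>a\<close>, and
      \<open>k\<close> is such that the tail outside it is
      \<open>k * Z2_approx \<beta> \<tau> a\<close>.\<close>
    define d where "d = q powr (1 / \<beta>) * sqrt a"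
    have d: "d > 0" using q a by (simp add: d_def)
    have d2: "d\<^sup>2 = q powr (2 / \<beta>) * a"
      using q a by (simp add: d_def power_mult_distrib powr_power)
    have "q * d powr (- \<beta>) = a powr (- \<beta> / 2)"
      using q a \<beta> by (simp add: d_def powr_mult powr_powr powr_half_sqrt[symmetric] powr_minus field_simps)
    moreover have "k * \<tau> powr (2 / \<beta>) = pi * q powr (2 / \<beta>)"
      using q \<tau> by (simp add: k_def powr_divide)
    ultimately have "pi * d\<^sup>2 * Z1 \<beta> (q * d powr (- \<beta>)) = k * Z2_approx \<beta> \<tau> a"
      using a \<beta> by (simp add: Z2_approx_eq_Z1 d2)
    then have Jd: "J d = ennreal (k * Z2_approx \<beta> \<tau> a)"
      using d by (simp add: J_tail)
    have nn: "k * Z2_approx \<beta> \<tau> a \<ge> 0"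
      using a k \<beta> by (simp add: Z2_approx_eq_Z1 Z1_nonneg)
    have "k * Z2_approx \<beta> \<tau> a \<le> j"
      using lower[OF d] j nn by (simp add: Jd)
    moreover have "j \<le> k * Z2_approx \<beta> \<tau> a + pi * q powr (2 / \<beta>) * a"
      using upper[OF d] j nn a by (simp add: Jd d2 mult.assoc flip: ennreal_plus)
    ultimately show ?thesis by simp
  qed
  have "((\<lambda>a. k * Z2_approx \<beta> \<tau> a - j) \<longlongrightarrow> 0) (at_right 0)"
  proof (rule Lim_null_comparison)
    show "eventually (\<lambda>a. norm (k * Z2_approx \<beta> \<tau> a - j) \<le> pi * q powr (2 / \<beta>) * a) (at_right 0)"
      using bound by (auto simp: eventually_at_right_less intro: eventually_mono[OF eventually_at_right_less])
    show "((\<lambda>a. pi * q powr (2 / \<beta>) * a) \<longlongrightarrow> 0) (at_right 0)"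
      by (auto intro!: tendsto_eq_intros)
  qed
  then have "((\<lambda>a. (k * Z2_approx \<beta> \<tau> a - j + j) / k) \<longlongrightarrow> (0 + j) / k) (at_right 0)"
    using k by (intro tendsto_intros) auto
  then have lim: "(Z2_approx \<beta> \<tau> \<longlongrightarrow> j / k) (at_right 0)"
    using k by simp
  then have "Z2 \<beta> \<tau> = j / k"
    unfolding Z2_def by (intro tendsto_Lim) auto
  then show ?lim ?int
    using lim k j q \<tau> by (simp_all add: J0_def \<phi>_def k_def)
qed

section \<open>Coverage given the serving distance\<close>

text \<open>The sum over each tier is a measurable function of that tier's counts. Independence of
  the count families therefore splits the expectation into one Laplace functional per tier.\<close>

lemma (in prob_space) laplace_functional_superposition:
  fixes Y :: "'i \<Rightarrow> nat \<Rightarrow> 'a \<Rightarrow> 'b::euclidean_space"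
  assumes I: "finite I"
    and Y: "\<And>m. m \<in> I \<Longrightarrow> homogeneous_poisson_process M (r m) (D m) (Y m)"
    and ind: "indep_vars (\<lambda>_. PiM (sets borel) (\<lambda>_. borel)) (\<lambda>m \<omega>. \<lambda>A\<in>sets borel. point_count (Y m) A \<omega>) I"
    and D: "\<And>m. m \<in> I \<Longrightarrow> D m \<in> sets borel"
    and v: "\<And>m. m \<in> I \<Longrightarrow> v m \<in> borel_measurable borel"
  shows "(\<integral>\<^sup>+\<omega>. exp_neg (\<Sum>m\<in>I. \<Sum>k. v m (Y m k \<omega>)) \<partial>M) =
    exp_neg (\<Sum>m\<in>I. ennreal (r m) * (\<integral>\<^sup>+y. (1 - exp_neg (v m y)) * indicator (D m) y \<partial>lborel))"
proof -
  define \<mu> where "\<mu> m = density lborel (\<lambda>z. ennreal (r m) * indicator (D m) z)" for m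
  \<comment> \<open>The function of the counts is chosen before the process and works for every
    sequence of points, since all of them lie in the space of \<open>borel\<close>.\<close>
  have "\<exists>\<Phi>. \<Phi> \<in> borel_measurable (PiM (sets borel) (\<lambda>_. borel)) \<and> (\<forall>(Z :: nat \<Rightarrow> 'a \<Rightarrow> 'b) \<omega>.
    (\<Sum>k. v m (Z k \<omega>)) = \<Phi> (\<lambda>A\<in>sets borel. point_count Z A \<omega>))" if "m \<in> I" for m
    using suminf_eq_counts[OF v[OF that]] by auto
  then obtain \<Phi> where \<Phi>: "\<And>m. m \<in> I \<Longrightarrow> \<Phi> m \<in> borel_measurable (PiM (sets borel) (\<lambda>_. borel))"
    "\<And>m (Z :: nat \<Rightarrow> 'a \<Rightarrow> 'b) \<omega>. m \<in> I \<Longrightarrow> (\<Sum>k. v m (Z k \<omega>)) = \<Phi> m (\<lambda>A\<in>sets borel. point_count Z A \<omega>)"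
    by metis
  have "(\<integral>\<^sup>+\<omega>. exp_neg (\<Sum>m\<in>I. \<Sum>k. v m (Y m k \<omega>)) \<partial>M) =
      (\<integral>\<^sup>+\<omega>. (\<Prod>m\<in>I. exp_neg (\<Phi> m (\<lambda>A\<in>sets borel. point_count (Y m) A \<omega>))) \<partial>M)"
    by (intro nn_integral_cong) (simp only: exp_neg_sum \<Phi>(2) cong: prod.cong)
  also have "\<dots> = (\<Prod>m\<in>I. \<integral>\<^sup>+\<omega>. exp_neg (\<Phi> m (\<lambda>A\<in>sets borel. point_count (Y m) A \<omega>)) \<partial>M)"
    by (intro indep_vars_nn_integral I indep_vars_compose2[OF ind, where Y = "\<lambda>m n. exp_neg (\<Phi> m n)"]
        measurable_compose[OF \<Phi>(1) measurable_exp_neg]) auto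
  also have "\<dots> = (\<Prod>m\<in>I. exp_neg (ennreal (r m) * (\<integral>\<^sup>+y. (1 - exp_neg (v m y)) * indicator (D m) y \<partial>lborel)))"
  proof (intro prod.cong refl)
    fix m assume m: "m \<in> I"
    have [measurable]: "D m \<in> sets borel" "v m \<in> borel_measurable borel"
      using D v m by auto
    have "sigma_finite_measure (\<mu> m)"
      unfolding \<mu>_def
      by (subst sigma_finite_measure.sigma_finite_iff_density_finite) (auto simp: sigma_finite_lborel indicator_def)
    then have "(\<integral>\<^sup>+\<omega>. exp_neg (\<Sum>k. v m (Y m k \<omega>)) \<partial>M) = exp_neg (\<integral>\<^sup>+y. 1 - exp_neg (v m y) \<partial>\<mu> m)"
      using Y[OF m] by (intro laplace_functional) (auto simp: homogeneous_poisson_process_def \<mu>_def)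
    also have "(\<integral>\<^sup>+y. 1 - exp_neg (v m y) \<partial>\<mu> m) = (\<integral>\<^sup>+y. ennreal (r m) * ((1 - exp_neg (v m y)) * indicator (D m) y) \<partial>lborel)"
      unfolding \<mu>_def by (subst nn_integral_density) (auto intro!: nn_integral_cong simp: mult_ac)
    also have "\<dots> = ennreal (r m) * (\<integral>\<^sup>+y. (1 - exp_neg (v m y)) * indicator (D m) y \<partial>lborel)"
      by (intro nn_integral_cmult) measurable
    finally show "(\<integral>\<^sup>+\<omega>. exp_neg (\<Phi> m (\<lambda>A\<in>sets borel. point_count (Y m) A \<omega>)) \<partial>M) =
        exp_neg (ennreal (r m) * (\<integral>\<^sup>+y. (1 - exp_neg (v m y)) * indicator (D m) y \<partial>lborel))"
      by (simp only: \<Phi>(2)[OF m])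
  qed
  finally show ?thesis
    by (simp only: exp_neg_sum)
qed

text \<open>Clearing the denominator survives the degenerate cases. With denominator 0 the quotient
  is \<infinity> or 0 according to whether \<open>g > 0\<close>; with \<open>t = \<infinity>\<close>
  the quotient is 0 and both sides fail.\<close>

lemma ennreal_less_divide_iff:
  assumes "0 < \<tau>" "0 < p" "0 \<le> n"
  shows "ennreal \<tau> < ennreal (p * g) / (t + ennreal n) \<longleftrightarrow> ennreal (\<tau> / p) * (t + ennreal n) < ennreal g"
proof (cases t)
  case (real u)
  show ?thesis
  proof (cases "u + n = 0")
    case True
    then have "t = 0" "n = 0" using real assms by auto
    then show ?thesis
      using assms by (cases "g > 0") (auto simp: ennreal_divide_zero ennreal_neg mult_nonneg_nonpos zero_less_mult_iff)
  next
    case False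
    then have "u + n > 0" using real assms by auto
    then have "ennreal (p * g) / (t + ennreal n) = ennreal (p * g / (u + n))"
      using assms real by (cases "g > 0") (auto simp: divide_ennreal ennreal_neg mult_nonneg_nonpos
          divide_nonpos_pos simp flip: ennreal_plus)
    moreover have "ennreal (\<tau> / p) * (t + ennreal n) = ennreal (\<tau> / p * (u + n))"
      using assms real by (simp flip: ennreal_plus ennreal_mult)
    moreover have "\<tau> < p * g / (u + n) \<longleftrightarrow> \<tau> / p * (u + n) < g"
      using assms \<open>u + n > 0\<close> by (simp add: field_simps)
    ultimately show ?thesis
      using assms real by (simp add: ennreal_less_iff)
  qed
next
  case top
  then show ?thesis using assms by (simp add: ennreal_mult_top)
qed

lemma (in prob_space) coverage_probability:
  assumes model: "interference_model M r P \<beta> i g h Y x"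
    and x: "x > 0" and \<tau>: "\<tau> > 0" and noise: "noise \<ge> 0"
    and P: "\<And>m. m \<in> {1..3} \<Longrightarrow> P m > 0" and i: "i \<in> {1..3}"
  shows "emeasure M {\<omega> \<in> space M. ennreal \<tau> < sinr P \<beta> noise i g h Y x \<omega>} =
    exp_neg (ennreal (\<tau> * x powr \<beta> / P i * noise) + (\<Sum>m = 1..3. ennreal (r m) *
      (\<integral>\<^sup>+y. ennreal (\<tau> * x powr \<beta> / P i * P m * norm y powr (- \<beta>) / (1 + \<tau> * x powr \<beta> / P i * P m * norm y powr (- \<beta>))) *
         indicator (tier_region P \<beta> i x m) y \<partial>lborel)))"
proof -
  define s where "s = \<tau> * x powr \<beta> / P i"
  have s: "s > 0" using x \<tau> P[OF i] by (simp add: s_def)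
  define G where "G = gain g h"
  define Link where "Link = insert None (Some ` ({1..3::nat} \<times> (UNIV :: nat set)))"
  define Ind where "Ind = {1..3::nat} \<times> (UNIV :: nat set)"
  define H where "H \<omega> = (\<lambda>l\<in>Link. G l \<omega>)" for \<omega>
  define Z where "Z \<omega> = (\<lambda>(m, k)\<in>Ind. Y m k \<omega>)" for \<omega>
  have Poi: "\<And>m. m \<in> {1..3} \<Longrightarrow> homogeneous_poisson_process M (r m) (tier_region P \<beta> i x m) (Y m)"
    and tiers: "indep_vars (\<lambda>_. PiM (sets borel) (\<lambda>_. borel)) (\<lambda>m \<omega>. \<lambda>A\<in>sets borel. point_count (Y m) A \<omega>) {1..3}"
    and D: "\<And>l. l \<in> Link \<Longrightarrow> distributed M lborel (G l) (exponential_density 1)"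
    and indG: "indep_vars (\<lambda>_. borel) G Link"
    and indGY: "indep_set (sets (vimage_algebra (space M) H (PiM Link (\<lambda>_. borel))))
       (sets (vimage_algebra (space M) Z (PiM Ind (\<lambda>_. borel))))"
    using model by (auto simp: interference_model_def G_def Link_def H_def[abs_def] Z_def[abs_def] Ind_def)
  have Ym: "Y m k \<in> borel_measurable M" if "m \<in> {1..3}" for m k
    using Poi[OF that] by (auto simp: homogeneous_poisson_process_def poisson_process_def)
  have Gm: "G l \<in> borel_measurable M" if "l \<in> Link" for l
    using D[OF that] by (auto dest: distributed_measurable)
  have Hm: "H \<in> M \<rightarrow>\<^sub>M PiM Link (\<lambda>_. borel)"
    unfolding H_def[abs_def] using Gm by (intro measurable_restrict) auto
  have Zm: "Z \<in> M \<rightarrow>\<^sub>M PiM Ind (\<lambda>_. borel)"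
    unfolding Z_def[abs_def] by (intro measurable_restrict) (auto intro: Ym simp: Ind_def)
  define a where "a z m k = s * P m * norm (z (m, k)) powr (- \<beta>)" for z :: "nat \<times> nat \<Rightarrow> real ^ 2" and m k
  have a_nonneg: "a z m k \<ge> 0" if "m \<in> {1..3}" for z m k
    using s P[OF that] by (simp add: a_def)
  \<comment> \<open>The coverage event as a set of pairs (gains, positions), so that the positions
    can be frozen at another sample point while the gains still vary.\<close>
  define C where "C = {(f, z). ennreal (s * noise) + (\<Sum>m = 1..3. \<Sum>k. ennreal (a z m k * f (Some (m, k)))) < ennreal (f None)}"
  have C: "C \<inter> space (PiM Link (\<lambda>_. borel) \<Otimes>\<^sub>M PiM Ind (\<lambda>_. borel)) \<in> sets (PiM Link (\<lambda>_. borel) \<Otimes>\<^sub>M PiM Ind (\<lambda>_. borel))"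
  proof -
    have [measurable]: "(\<lambda>p. fst p l) \<in> borel_measurable (PiM Link (\<lambda>_. borel) \<Otimes>\<^sub>M PiM Ind (\<lambda>_. borel))"
      if "l \<in> Link" for l :: "(nat \<times> nat) option"
      using that by (intro measurable_compose[OF measurable_fst] measurable_component_singleton)
    have [measurable]: "(\<lambda>p. snd p l) \<in> borel_measurable (PiM Link (\<lambda>_. borel) \<Otimes>\<^sub>M PiM Ind (\<lambda>_. borel))"
      if "l \<in> Ind" for l :: "nat \<times> nat"
      using that by (intro measurable_compose[OF measurable_snd] measurable_component_singleton)
    have "(\<lambda>p. ennreal (s * noise) + (\<Sum>m = 1..3. \<Sum>k. ennreal (a (snd p) m k * fst p (Some (m, k)))))
        \<in> borel_measurable (PiM Link (\<lambda>_. borel) \<Otimes>\<^sub>M PiM Ind (\<lambda>_. borel))"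
      unfolding a_def
    proof (intro borel_measurable_add borel_measurable_const borel_measurable_sum borel_measurable_suminf_order)
      fix m k :: nat assume "m \<in> {1..3}"
      then have "Some (m, k) \<in> Link" "(m, k) \<in> Ind" by (auto simp: Link_def Ind_def)
      then show "(\<lambda>p :: ((nat \<times> nat) option \<Rightarrow> real) \<times> (nat \<times> nat \<Rightarrow> real ^ 2). ennreal (s * P m * norm (snd p (m, k)) powr (- \<beta>) * fst p (Some (m, k))))
        \<in> borel_measurable (PiM Link (\<lambda>_. borel) \<Otimes>\<^sub>M PiM Ind (\<lambda>_. borel))"
        by measurable
    qed
    moreover have "(\<lambda>p. ennreal (fst p None)) \<in> borel_measurable (PiM Link (\<lambda>_. borel) \<Otimes>\<^sub>M PiM Ind (\<lambda>_. borel))"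
    proof -
      have "None \<in> Link" by (simp add: Link_def)
      then show ?thesis by measurable
    qed
    ultimately have "{p \<in> space (PiM Link (\<lambda>_. borel) \<Otimes>\<^sub>M PiM Ind (\<lambda>_. borel)).
        ennreal (s * noise) + (\<Sum>m = 1..3. \<Sum>k. ennreal (a (snd p) m k * fst p (Some (m, k)))) < ennreal (fst p None)}
        \<in> sets (PiM Link (\<lambda>_. borel) \<Otimes>\<^sub>M PiM Ind (\<lambda>_. borel))"
      by measurable
    then show ?thesis
      by (rule back_subst[of "\<lambda>A. A \<in> _"]) (auto simp: C_def)
  qed
  have ev: "ennreal \<tau> < sinr P \<beta> noise i g h Y x \<omega> \<longleftrightarrow> (H \<omega>, Z \<omega>) \<in> C" for \<omega>
  proof -
    have "ennreal \<tau> < sinr P \<beta> noise i g h Y x \<omega> \<longleftrightarrow>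
        ennreal s * (interference P \<beta> h Y \<omega> + ennreal noise) < ennreal (g \<omega>)"
      using ennreal_less_divide_iff[of \<tau> "P i * x powr (- \<beta>)" noise "g \<omega>"] \<tau> P[OF i] x noise
      by (simp add: sinr_def s_def powr_minus divide_inverse mult_ac)
    also have "ennreal s * (interference P \<beta> h Y \<omega> + ennreal noise) =
       ennreal (s * noise) + (\<Sum>m = 1..3. \<Sum>k. ennreal (a (Z \<omega>) m k * H \<omega> (Some (m, k))))"
    proof -
      have "ennreal s * interference P \<beta> h Y \<omega> = (\<Sum>m = 1..3. \<Sum>k. ennreal s * ennreal (P m * h m k \<omega> * norm (Y m k \<omega>) powr (- \<beta>)))"
        unfolding interference_def by (simp add: sum_distrib_left)
      also have "\<dots> = (\<Sum>m = 1..3. \<Sum>k. ennreal (a (Z \<omega>) m k * H \<omega> (Some (m, k))))"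
        using s by (intro sum.cong suminf_cong refl)
          (auto simp: a_def Z_def H_def Ind_def Link_def G_def gain_def ennreal_mult'[symmetric] mult_ac)
      finally show ?thesis
        using s noise by (simp add: distrib_left ennreal_mult add.commute)
    qed
    also have "g \<omega> = H \<omega> None"
      by (simp add: H_def Link_def G_def gain_def)
    finally show ?thesis
      by (simp add: C_def)
  qed
  have "emeasure M {\<omega> \<in> space M. ennreal \<tau> < sinr P \<beta> noise i g h Y x \<omega>} =
      (\<integral>\<^sup>+\<omega>. indicator C (H \<omega>, Z \<omega>) \<partial>M)" (is "emeasure M ?E = _")
  proof -
    have "?E = (\<lambda>\<omega>. (H \<omega>, Z \<omega>)) -` (C \<inter> space (PiM Link (\<lambda>_. borel) \<Otimes>\<^sub>M PiM Ind (\<lambda>_. borel))) \<inter> space M"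
      using ev measurable_space[OF Hm] measurable_space[OF Zm] by (auto simp: space_pair_measure)
    also have "\<dots> \<in> sets M"
      by (rule measurable_sets[OF measurable_Pair[OF Hm Zm] C])
    finally have "emeasure M ?E = (\<integral>\<^sup>+\<omega>. indicator ?E \<omega> \<partial>M)"
      by (rule nn_integral_indicator[symmetric])
    also have "\<dots> = (\<integral>\<^sup>+\<omega>. indicator C (H \<omega>, Z \<omega>) \<partial>M)"
      by (intro nn_integral_cong) (auto simp: indicator_def ev)
    finally show ?thesis .
  qed
  also have "\<dots> = (\<integral>\<^sup>+\<omega>'. (\<integral>\<^sup>+\<omega>. indicator C (H \<omega>, Z \<omega>') \<partial>M) \<partial>M)"
    using C by (intro indep_set_nn_integral_Fubini[OF Hm Zm indGY]) (simp add: borel_measurable_indicator_iff)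
  also have "\<dots> = (\<integral>\<^sup>+\<omega>'. exp_neg (ennreal (s * noise) + (\<Sum>m = 1..3. \<Sum>k. ennreal (ln (1 + a (Z \<omega>') m k)))) \<partial>M)"
  proof (rule nn_integral_cong)
    fix \<omega>' assume "\<omega>' \<in> space M"
    \<comment> \<open>The coefficients are set to 0 outside the three tiers because
      \<open>exponential_coverage\<close> asks for nonnegativity at every index, while the powers
      are known to be positive for tiers 1 to 3 only.\<close>
    define b where "b m k = (if m \<in> {1..3} then a (Z \<omega>') m k else 0)" for m k
    have "(\<integral>\<^sup>+\<omega>. indicator C (H \<omega>, Z \<omega>') \<partial>M) =
        emeasure M {\<omega> \<in> space M. ennreal (s * noise) + (\<Sum>m = 1..3. \<Sum>k. ennreal (b m k * G (Some (m, k)) \<omega>)) < ennreal (G None \<omega>)}" (is "_ = emeasure M ?E")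
    proof -
      have eq: "(H \<omega>, Z \<omega>') \<in> C \<longleftrightarrow> \<omega> \<in> ?E" if "\<omega> \<in> space M" for \<omega>
      proof -
        have "(\<Sum>m = 1..3. \<Sum>k. ennreal (a (Z \<omega>') m k * H \<omega> (Some (m, k)))) =
            (\<Sum>m = 1..3. \<Sum>k. ennreal (b m k * G (Some (m, k)) \<omega>))"
          by (intro sum.cong suminf_cong refl) (auto simp: H_def Link_def b_def)
        moreover have "H \<omega> None = G None \<omega>"
          by (simp add: H_def Link_def)
        ultimately show ?thesis
          using that by (simp add: C_def)
      qed
      have HZ: "(\<lambda>\<omega>. (H \<omega>, Z \<omega>')) \<in> M \<rightarrow>\<^sub>M PiM Link (\<lambda>_. borel) \<Otimes>\<^sub>M PiM Ind (\<lambda>_. borel)"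
        using measurable_space[OF Zm \<open>\<omega>' \<in> space M\<close>] by (intro measurable_Pair Hm) auto
      from measurable_sets[OF HZ C] have "?E \<in> sets M"
        by (rule back_subst[of "\<lambda>A. A \<in> _"])
          (use eq measurable_space[OF HZ] in auto)
      then have "emeasure M ?E = (\<integral>\<^sup>+\<omega>. indicator ?E \<omega> \<partial>M)"
        by (rule nn_integral_indicator[symmetric])
      also have "\<dots> = (\<integral>\<^sup>+\<omega>. indicator C (H \<omega>, Z \<omega>') \<partial>M)"
        using eq by (intro nn_integral_cong) (auto simp: indicator_def)
      finally show ?thesis ..
    qed
    also have "\<dots> = exp_neg (ennreal (s * noise) + (\<Sum>m = 1..3. \<Sum>k. ennreal (ln (1 + b m k))))"
      using D indG a_nonneg unfolding Link_def by (intro exponential_coverage) (auto simp: b_def)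
    finally show "(\<integral>\<^sup>+\<omega>. indicator C (H \<omega>, Z \<omega>') \<partial>M) =
        exp_neg (ennreal (s * noise) + (\<Sum>m = 1..3. \<Sum>k. ennreal (ln (1 + a (Z \<omega>') m k))))"
      by (simp add: b_def cong: sum.cong_simp)
  qed
  also have "\<dots> = (\<integral>\<^sup>+\<omega>. exp_neg (ennreal (s * noise)) * exp_neg (\<Sum>m = 1..3. \<Sum>k. ennreal (ln (1 + s * P m * norm (Y m k \<omega>) powr (- \<beta>)))) \<partial>M)"
    by (simp add: exp_neg_add a_def Z_def Ind_def cong: sum.cong_simp)
  also have "\<dots> = exp_neg (ennreal (s * noise)) * (\<integral>\<^sup>+\<omega>. exp_neg (\<Sum>m = 1..3. \<Sum>k. ennreal (ln (1 + s * P m * norm (Y m k \<omega>) powr (- \<beta>)))) \<partial>M)"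
  proof (intro nn_integral_cmult measurable_compose[OF _ measurable_exp_neg] borel_measurable_sum borel_measurable_suminf_order)
    fix m k :: nat assume "m \<in> {1..3}"
    note Ym[OF this, measurable]
    show "(\<lambda>\<omega>. ennreal (ln (1 + s * P m * norm (Y m k \<omega>) powr (- \<beta>)))) \<in> borel_measurable M"
      by measurable
  qed
  also have "(\<integral>\<^sup>+\<omega>. exp_neg (\<Sum>m = 1..3. \<Sum>k. ennreal (ln (1 + s * P m * norm (Y m k \<omega>) powr (- \<beta>)))) \<partial>M) =
      exp_neg (\<Sum>m = 1..3. ennreal (r m) * (\<integral>\<^sup>+y. (1 - exp_neg (ennreal (ln (1 + s * P m * norm y powr (- \<beta>))))) *
         indicator (tier_region P \<beta> i x m) y \<partial>lborel))"
  proof (rule laplace_functional_superposition[OF _ Poi tiers])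
    show "tier_region P \<beta> i x m \<in> sets borel" for m
      by (auto simp: tier_region_def intro!: borel_closed closed_Collect_le continuous_intros)
    show "(\<lambda>y::real ^ 2. ennreal (ln (1 + s * P m * norm y powr (- \<beta>)))) \<in> borel_measurable borel" for m
      by measurable
  qed auto
  also have "(\<Sum>m = 1..3. ennreal (r m) * (\<integral>\<^sup>+y. (1 - exp_neg (ennreal (ln (1 + s * P m * norm (y :: real ^ 2) powr (- \<beta>))))) *
         indicator (tier_region P \<beta> i x m) y \<partial>lborel)) =
      (\<Sum>m = 1..3. ennreal (r m) * (\<integral>\<^sup>+y. ennreal (s * P m * norm (y :: real ^ 2) powr (- \<beta>) / (1 + s * P m * norm y powr (- \<beta>))) *
         indicator (tier_region P \<beta> i x m) y \<partial>lborel))"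
  proof (intro sum.cong refl arg_cong2[where f = "(*)"] nn_integral_cong)
    fix m :: nat and y :: "real ^ 2" assume "m \<in> {1..3}"
    define v where "v = s * P m * norm y powr (- \<beta>)"
    have v: "v \<ge> 0" using s P[OF \<open>m \<in> {1..3}\<close>] by (simp add: v_def)
    then have "1 - exp_neg (ennreal (ln (1 + v))) = ennreal (1 - 1 / (1 + v))"
      by (simp add: exp_neg_ennreal exp_minus divide_inverse ennreal_minus[symmetric])
    also have "1 - 1 / (1 + v) = v / (1 + v)"
      using v by (simp add: field_simps)
    finally show "1 - exp_neg (ennreal (ln (1 + s * P m * norm y powr (- \<beta>)))) =
        ennreal (s * P m * norm y powr (- \<beta>) / (1 + s * P m * norm y powr (- \<beta>)))"
      by (simp only: v_def)
  qed
  finally show ?thesis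
    by (simp add: exp_neg_add s_def)
qed

section \<open>The exponent contributed by each tier\<close>

lemma Z2_nonneg:
  assumes "\<beta> > 2" "\<tau> > 0"
  shows "Z2 \<beta> \<tau> \<ge> 0"
proof (rule tendsto_lowerbound)
  show "(Z2_approx \<beta> \<tau> \<longlongrightarrow> Z2 \<beta> \<tau>) (at_right 0)"
    \<comment> \<open>The convergence statement does not mention \<open>q\<close>, so any positive
      value serves; 1 is taken.\<close>
    by (rule nn_integral_path_loss_plane(1)[OF assms(1) zero_less_one assms(2)])
  show "eventually (\<lambda>a. 0 \<le> Z2_approx \<beta> \<tau> a) (at_right 0)"
    using eventually_at_right_less[of 0]
    by eventually_elim (use assms in \<open>simp add: Z2_approx_eq_Z1 Z1_nonneg\<close>)
qed simp

lemma powr_two_div_mult: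
  fixes x p \<beta> :: real
  assumes "x \<ge> 0" "p \<ge> 0" "\<beta> \<noteq> 0"
  shows "(x powr \<beta> * p) powr (2 / \<beta>) = x\<^sup>2 * p powr (2 / \<beta>)"
    and "(x * p powr (1 / \<beta>))\<^sup>2 = x\<^sup>2 * p powr (2 / \<beta>)"
proof -
  show "(x powr \<beta> * p) powr (2 / \<beta>) = x\<^sup>2 * p powr (2 / \<beta>)"
    using assms by (cases "x = 0") (auto simp: powr_mult powr_powr)
  show "(x * p powr (1 / \<beta>))\<^sup>2 = x\<^sup>2 * p powr (2 / \<beta>)"
    by (simp add: power_mult_distrib power2_eq_square flip: powr_add)
qed

text \<open>Interferers of tier 1 fill the whole plane, those of the other tiers avoid a disc. The
  value is per unit intensity, with the scale \<pi>
  \<open>x\<^sup>2 * (P m / P i) powr (2 / \<beta>)\<close> divided out.\<close>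

definition tier_exponent :: "real \<Rightarrow> real \<Rightarrow> nat \<Rightarrow> real" where
  "tier_exponent \<beta> \<tau> m = (if m = 1 then Z2 \<beta> \<tau> else Z1 \<beta> \<tau>)"

text \<open>At the exclusion radius \<open>d\<close> the mean received powers of interferer and
  server coincide, hence \<open>q * d powr (- \<beta>) = \<tau>\<close> and \<open>Z1\<close> is
  evaluated at \<tau>. For tier 1 there is no such radius and the dependence on \<open>x\<close> is
  the pure scaling of areas.\<close>

lemma nn_integral_tier:
  fixes P :: "nat \<Rightarrow> real"
  assumes \<beta>: "\<beta> > 2" and x: "x > 0" and \<tau>: "\<tau> > 0" and P: "P m > 0" "P i > 0"
  shows "(\<integral>\<^sup>+y. ennreal (\<tau> * x powr \<beta> / P i * P m * norm y powr (- \<beta>) / (1 + \<tau> * x powr \<beta> / P i * P m * norm y powr (- \<beta>))) *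
         indicator (tier_region P \<beta> i x m) y \<partial>lborel) =
    ennreal (pi * x\<^sup>2 * (P m / P i) powr (2 / \<beta>) * tier_exponent \<beta> \<tau> m)"
proof -
  define q where "q = \<tau> * x powr \<beta> / P i * P m"
  have q: "q > 0" using assms by (simp add: q_def)
  show ?thesis
  proof (cases "m = 1")
    case True
    have q\<tau>: "q / \<tau> = x powr \<beta> * (P m / P i)"
      using \<tau> by (simp add: q_def)
    have eq: "pi * (q / \<tau>) powr (2 / \<beta>) * Z2 \<beta> \<tau> = pi * x\<^sup>2 * (P m / P i) powr (2 / \<beta>) * Z2 \<beta> \<tau>"
      unfolding q\<tau> by (subst powr_two_div_mult(1)) (use x P \<beta> in auto)
    show ?thesis
      using nn_integral_path_loss_plane(2)[OF \<beta> q \<tau>, unfolded eq, unfolded q_def] True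
      by (simp add: tier_region_def tier_exponent_def)
  next
    case False
    define d where "d = x * (P m / P i) powr (1 / \<beta>)"
    have d: "d > 0" using x P by (simp add: d_def)
    have "d powr (- \<beta>) = x powr (- \<beta>) * (P i / P m)"
      using x P \<beta> by (simp add: d_def powr_mult powr_powr powr_minus field_simps)
    then have "q * d powr (- \<beta>) = \<tau>"
      using x P by (simp add: q_def powr_minus field_simps)
    moreover have "d\<^sup>2 = x\<^sup>2 * (P m / P i) powr (2 / \<beta>)"
      unfolding d_def using x P \<beta> by (intro powr_two_div_mult) auto
    ultimately show ?thesis
      using nn_integral_path_loss_tail[OF \<beta> less_imp_le[OF q] d] False
      by (simp only: tier_region_def tier_exponent_def q_def[symmetric] d_def[symmetric] if_False mult.assoc)
  qed
qed

text \<open>Complement of the coverage event. All terms of the exponent are nonnegative reals, so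
  \<open>exp_neg\<close> becomes an ordinary exponential.\<close>

lemma (in prob_space) outage_probability:
  assumes model: "interference_model M r P \<beta> i g h Y x"
    and \<beta>: "\<beta> > 2" and x: "x > 0" and \<tau>: "\<tau> > 0" and noise: "noise \<ge> 0"
    and P: "\<And>m. m \<in> {1..3} \<Longrightarrow> P m > 0" and i: "i \<in> {1..3}"
    and r: "\<And>m. m \<in> {1..3} \<Longrightarrow> r m \<ge> 0"
    and meas: "{\<omega> \<in> space M. sinr P \<beta> noise i g h Y x \<omega> \<le> ennreal \<tau>} \<in> sets M"
  shows "prob {\<omega> \<in> space M. sinr P \<beta> noise i g h Y x \<omega> \<le> ennreal \<tau>} =
    1 - exp (- (\<tau> * x powr \<beta> / P i * noise +
      pi * x\<^sup>2 * (\<Sum>m = 1..3. r m * (P m / P i) powr (2 / \<beta>) * tier_exponent \<beta> \<tau> m)))"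
proof -
  have nn: "tier_exponent \<beta> \<tau> m \<ge> 0" for m
    using \<beta> \<tau> by (simp add: tier_exponent_def Z1_nonneg Z2_nonneg)
  have "emeasure M {\<omega> \<in> space M. ennreal \<tau> < sinr P \<beta> noise i g h Y x \<omega>} =
      exp_neg (ennreal (\<tau> * x powr \<beta> / P i * noise) +
        (\<Sum>m = 1..3. ennreal (r m) * ennreal (pi * x\<^sup>2 * (P m / P i) powr (2 / \<beta>) * tier_exponent \<beta> \<tau> m)))"
    by (rule trans[OF coverage_probability[OF model x \<tau> noise _ i]], rule P, assumption)
      (intro arg_cong[where f = exp_neg] arg_cong2[where f = "(+)"] refl sum.cong arg_cong2[where f = "(*)"] nn_integral_tier \<beta> x \<tau> P i)
  also have "(\<Sum>m = 1..3. ennreal (r m) * ennreal (pi * x\<^sup>2 * (P m / P i) powr (2 / \<beta>) * tier_exponent \<beta> \<tau> m)) =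
      (\<Sum>m = 1..3. ennreal (r m * (pi * x\<^sup>2 * (P m / P i) powr (2 / \<beta>) * tier_exponent \<beta> \<tau> m)))"
    using nn r by (intro sum.cong refl) (simp add: ennreal_mult)
  also have "\<dots> = ennreal (\<Sum>m = 1..3. r m * (pi * x\<^sup>2 * (P m / P i) powr (2 / \<beta>) * tier_exponent \<beta> \<tau> m))"
    using nn r by (intro sum_ennreal) auto
  also have "(\<Sum>m = 1..3. r m * (pi * x\<^sup>2 * (P m / P i) powr (2 / \<beta>) * tier_exponent \<beta> \<tau> m)) =
      pi * x\<^sup>2 * (\<Sum>m = 1..3. r m * (P m / P i) powr (2 / \<beta>) * tier_exponent \<beta> \<tau> m)"
    unfolding sum_distrib_left by (intro sum.cong) (simp_all add: mult_ac)
  also have "exp_neg (ennreal (\<tau> * x powr \<beta> / P i * noise) +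
        ennreal (pi * x\<^sup>2 * (\<Sum>m = 1..3. r m * (P m / P i) powr (2 / \<beta>) * tier_exponent \<beta> \<tau> m))) =
      ennreal (exp (- (\<tau> * x powr \<beta> / P i * noise +
        pi * x\<^sup>2 * (\<Sum>m = 1..3. r m * (P m / P i) powr (2 / \<beta>) * tier_exponent \<beta> \<tau> m))))"
  proof -
    have "\<tau> * x powr \<beta> / P i * noise \<ge> 0"
      using \<tau> noise P[OF i] by simp
    moreover have "pi * x\<^sup>2 * (\<Sum>m = 1..3. r m * (P m / P i) powr (2 / \<beta>) * tier_exponent \<beta> \<tau> m) \<ge> 0"
      using nn r by (intro mult_nonneg_nonneg sum_nonneg) auto
    ultimately show ?thesis
      by (simp only: ennreal_plus[symmetric] exp_neg_ennreal add_nonneg_nonneg)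
  qed
  finally have "prob {\<omega> \<in> space M. ennreal \<tau> < sinr P \<beta> noise i g h Y x \<omega>} =
      exp (- (\<tau> * x powr \<beta> / P i * noise + pi * x\<^sup>2 * (\<Sum>m = 1..3. r m * (P m / P i) powr (2 / \<beta>) * tier_exponent \<beta> \<tau> m)))"
    by (simp add: emeasure_eq_measure)
  moreover have "{\<omega> \<in> space M. ennreal \<tau> < sinr P \<beta> noise i g h Y x \<omega>} =
      space M - {\<omega> \<in> space M. sinr P \<beta> noise i g h Y x \<omega> \<le> ennreal \<tau>}"
    by auto
  ultimately show ?thesis
    using prob_compl[OF meas] by simp
qed

section \<open>The average outage probability\<close>

lemma interference_model_measurable:
  assumes "interference_model M r P \<beta> i g h Y x"
  shows "g \<in> borel_measurable M"
    and "m \<in> {1..3} \<Longrightarrow> h m k \<in> borel_measurable M"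
    and "m \<in> {1..3} \<Longrightarrow> Y m k \<in> borel_measurable M"
proof -
  have D: "distributed M lborel (gain g h l) (exponential_density 1)" if "l \<in> insert None (Some ` ({1..3} \<times> UNIV))" for l
    using assms that unfolding interference_model_def by blast
  show "g \<in> borel_measurable M"
    using distributed_measurable[OF D[of None]] by (simp add: gain_def)
  show "h m k \<in> borel_measurable M" if "m \<in> {1..3}"
    using distributed_measurable[OF D[of "Some (m, k)"]] that by (simp add: gain_def)
  show "Y m k \<in> borel_measurable M" if "m \<in> {1..3}"
    using assms that by (auto simp: interference_model_def homogeneous_poisson_process_def poisson_process_def)
qed

lemma measurable_sinr:
  assumes "g \<in> borel_measurable M"
    and "\<And>m k. m \<in> {1..3} \<Longrightarrow> h m k \<in> borel_measurable M"
    and "\<And>m k. m \<in> {1..3} \<Longrightarrow> Y m k \<in> borel_measurable M"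
  shows "(\<lambda>(x, \<omega>). sinr P \<beta> noise i g h Y x \<omega>) \<in> borel_measurable (borel \<Otimes>\<^sub>M M)"
proof -
  have [measurable]: "interference P \<beta> h Y \<in> borel_measurable M"
    unfolding interference_def
  proof (intro borel_measurable_sum borel_measurable_suminf_order)
    fix m k :: nat assume "m \<in> {1..3}"
    note assms(2,3)[OF this, measurable]
    show "(\<lambda>\<omega>. ennreal (P m * h m k \<omega> * norm (Y m k \<omega>) powr (- \<beta>))) \<in> borel_measurable M"
      by measurable
  qed
  note assms(1)[measurable]
  show ?thesis
    unfolding sinr_def by measurable
qed

text \<open>Both facts come from one jointly measurable set of pairs: its sections are events, and a
  measurable kernel evaluated on the sections is measurable in \<open>x\<close>.\<close>

lemma measurable_kernel_sinr_le:
  assumes Q: "Q \<in> borel \<rightarrow>\<^sub>M prob_algebra M"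
    and sinr: "(\<lambda>(x, \<omega>). sinr P \<beta> noise i g h Y x \<omega>) \<in> borel_measurable (borel \<Otimes>\<^sub>M M)"
  shows "(\<lambda>x. measure (Q x) {\<omega> \<in> space (Q x). sinr P \<beta> noise i g h Y x \<omega> \<le> c}) \<in> borel_measurable borel"
    and "{\<omega> \<in> space (Q x). sinr P \<beta> noise i g h Y x \<omega> \<le> c} \<in> sets (Q x)"
proof -
  have sets: "sets (Q x) = sets M" for x
    using Q by (auto dest!: measurable_prob_algebraD subprob_measurableD(2))
  then have space: "space (Q x) = space M" for x
    by (rule sets_eq_imp_space_eq)
  have "{p \<in> space (borel \<Otimes>\<^sub>M M). (\<lambda>(x, \<omega>). sinr P \<beta> noise i g h Y x \<omega>) p \<le> c} \<in> sets (borel \<Otimes>\<^sub>M M)"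
    using sinr by measurable
  also have "{p \<in> space (borel \<Otimes>\<^sub>M M). (\<lambda>(x, \<omega>). sinr P \<beta> noise i g h Y x \<omega>) p \<le> c} =
      Sigma (space borel) (\<lambda>x. {\<omega> \<in> space M. sinr P \<beta> noise i g h Y x \<omega> \<le> c})"
    by (auto simp: space_pair_measure)
  finally have S: "Sigma (space borel) (\<lambda>x. {\<omega> \<in> space M. sinr P \<beta> noise i g h Y x \<omega> \<le> c}) \<in> sets (borel \<Otimes>\<^sub>M M)" .
  show "(\<lambda>x. measure (Q x) {\<omega> \<in> space (Q x). sinr P \<beta> noise i g h Y x \<omega> \<le> c}) \<in> borel_measurable borel"
    unfolding space by (rule measure_measurable_prob_algebra2[OF S Q])
  have "Pair x -` Sigma (space borel) (\<lambda>x. {\<omega> \<in> space M. sinr P \<beta> noise i g h Y x \<omega> \<le> c}) \<in> sets M"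
    using S by (rule sets_Pair1)
  also have "Pair x -` Sigma (space borel) (\<lambda>x. {\<omega> \<in> space M. sinr P \<beta> noise i g h Y x \<omega> \<le> c}) =
      {\<omega> \<in> space M. sinr P \<beta> noise i g h Y x \<omega> \<le> c}"
    by auto
  finally show "{\<omega> \<in> space (Q x). sinr P \<beta> noise i g h Y x \<omega> \<le> c} \<in> sets (Q x)"
    unfolding sets space .
qed

text \<open>The conditional outage probability is \<open>1 - E x\<close> for almost every relevant
  distance, and the serving density integrates to 1. The hypothesis \<open>pos\<close> makes that
  density nonnegative, so it is not truncated by \<open>ennreal\<close>.\<close>

lemma outage_prob_eq:
  fixes lam r P :: "nat \<Rightarrow> real"
  assumes model: "case2_model M X Q lam r P \<beta> i g h Y"
    and \<beta>: "\<beta> > 2" and \<tau>: "\<tau> > 0" and noise: "noise \<ge> 0"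
    and P: "\<And>m. m \<in> {1..3} \<Longrightarrow> P m > 0" and i: "i \<in> {1..3}"
    and r: "\<And>m. m \<in> {1..3} \<Longrightarrow> r m \<ge> 0"
    and pos: "lam i / assoc_prob lam P \<beta> {2..3} i \<ge> 0"
  shows "outage_prob Q lam P \<beta> noise i g h Y \<tau> =
    1 - (LBINT x:{0<..}. exp (- (\<tau> * x powr \<beta> / P i * noise +
      pi * x\<^sup>2 * (\<Sum>m = 1..3. r m * (P m / P i) powr (2 / \<beta>) * tier_exponent \<beta> \<tau> m))) * serving_distance_density lam P \<beta> i x)"
proof -
  define f where "f = serving_distance_density lam P \<beta> i"
  define E where "E x = exp (- (\<tau> * x powr \<beta> / P i * noise +
      pi * x\<^sup>2 * (\<Sum>m = 1..3. r m * (P m / P i) powr (2 / \<beta>) * tier_exponent \<beta> \<tau> m)))" for x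
  define p where "p x = measure (Q x) {\<omega> \<in> space (Q x). sinr P \<beta> noise i g h Y x \<omega> \<le> ennreal \<tau>}" for x
  interpret prob_space M
    using model by (simp add: case2_model_def)
  have D: "distributed M lborel X (\<lambda>x. ennreal (f x))" and Q: "Q \<in> borel \<rightarrow>\<^sub>M prob_algebra M"
    and AE: "AE x in distr M borel X. interference_model (Q x) r P \<beta> i g h Y x"
    using model by (simp_all add: case2_model_def f_def regular_conditional_prob_def)
  have [measurable]: "X \<in> borel_measurable M"
    using distributed_measurable[OF D] by simp
  have sets: "sets (Q x) = sets M" for x
    using Q by (auto dest!: measurable_prob_algebraD subprob_measurableD(2))
  have probQ: "prob_space (Q x)" for x
    using measurable_space[OF Q, of x] by (auto simp: space_prob_algebra)
  \<comment> \<open>The functions \<open>g\<close>, \<open>h\<close>, \<open>Y\<close> are the same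
    for all distances and each \<open>Q x\<close> has the \<sigma>-algebra of \<open>M\<close>, so
    the model at a single distance yields their measurability. Such a distance exists because the
    model holds almost surely under a probability law.\<close>
  obtain x0 where x0: "interference_model (Q x0) r P \<beta> i g h Y x0"
  proof -
    interpret X: prob_space "distr M borel X"
      by (rule prob_space_distr) measurable
    have "\<exists>x. interference_model (Q x) r P \<beta> i g h Y x"
    proof (rule ccontr)
      assume "\<nexists>x. interference_model (Q x) r P \<beta> i g h Y x"
      with AE have "AE x in distr M borel X. False"
        by simp
      then show False
        by (simp add: X.AE_False)
    qed
    then show ?thesis
      using that by blast
  qed
  have sinr: "(\<lambda>(x, \<omega>). sinr P \<beta> noise i g h Y x \<omega>) \<in> borel_measurable (borel \<Otimes>\<^sub>M M)"
    by (intro measurable_sinr; subst measurable_cong_sets[OF sets[of x0] refl, symmetric])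
      (auto intro: interference_model_measurable[OF x0])
  have [measurable]: "p \<in> borel_measurable borel"
    unfolding p_def[abs_def] by (rule measurable_kernel_sinr_le(1)[OF Q sinr])
  have [measurable]: "f \<in> borel_measurable borel"
    unfolding f_def serving_distance_density_def[abs_def] by measurable
  have [measurable]: "E \<in> borel_measurable borel"
    unfolding E_def[abs_def] by measurable
  have f_nonneg: "f x \<ge> 0" for x
  proof -
    have "2 * pi * lam i / assoc_prob lam P \<beta> {2..3} i \<ge> 0"
      using mult_nonneg_nonneg[OF _ pos, of "2 * pi"] by simp
    then show ?thesis
      unfolding f_def serving_distance_density_def
      by (cases "x > 0") (simp_all only: if_True if_False mult_nonneg_nonneg exp_ge_zero less_imp_le order.refl)
  qed
  have nn: "tier_exponent \<beta> \<tau> m \<ge> 0" for m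
    using \<beta> \<tau> by (simp add: tier_exponent_def Z1_nonneg Z2_nonneg)
  have E_le: "0 \<le> E x" "E x \<le> 1" for x
  proof -
    have "\<tau> * x powr \<beta> / P i * noise \<ge> 0"
      using \<tau> noise P[OF i] by simp
    moreover have "pi * x\<^sup>2 * (\<Sum>m = 1..3. r m * (P m / P i) powr (2 / \<beta>) * tier_exponent \<beta> \<tau> m) \<ge> 0"
      using nn r by (intro mult_nonneg_nonneg sum_nonneg) auto
    ultimately show "0 \<le> E x" "E x \<le> 1"
      by (simp_all only: E_def exp_ge_zero exp_le_one_iff neg_le_0_iff_le add_nonneg_nonneg)
  qed
  \<comment> \<open>A statement about almost all values of \<open>X\<close> concerns Lebesgue-almost
    all \<open>x\<close> with positive density. Where the density is 0, both sides of the next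
    identity vanish.\<close>
  have "AE x in lborel. 0 < ennreal (f x) \<longrightarrow> interference_model (Q x) r P \<beta> i g h Y x"
  proof -
    have "distr M borel X = density lborel (\<lambda>x. ennreal (f x))"
      using distributed_distr_eq_density[OF D] by (metis distr_cong sets_lborel)
    from AE[unfolded this] show ?thesis
      by (subst (asm) AE_density) auto
  qed
  then have AE_pf: "AE x \<in> {0<..} in lborel. p x * f x = f x - E x * f x"
  proof eventually_elim
    case (elim x)
    show ?case
    proof
      assume "x \<in> {0<..}"
      show "p x * f x = f x - E x * f x"
      proof (cases "f x = 0")
        case False
        then have mx: "interference_model (Q x) r P \<beta> i g h Y x"
          using elim f_nonneg[of x] by auto
        interpret Q: prob_space "Q x" by (rule probQ)
        have "p x = 1 - E x"
          unfolding p_def E_def using \<open>x \<in> {0<..}\<close>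
          by (intro Q.outage_probability[OF mx \<beta> _ \<tau> noise P i r] measurable_kernel_sinr_le(2)[OF Q sinr]) auto
        then show ?thesis by (simp only: left_diff_distrib mult_1_left)
      qed simp
    qed
  qed
  \<comment> \<open>The total mass 1 is read off from \<open>f\<close> being the density of a random
    variable; no Gaussian integral is computed.\<close>
  have int_f: "integrable lborel f" and f1: "(\<integral>x. f x \<partial>lborel) = 1"
    using distributed_integrable[OF D, of "\<lambda>_. 1"] distributed_integral[OF D, of "\<lambda>_. 1"] f_nonneg
    by (simp_all add: prob_space)
  have indf: "indicator {0<..} x *\<^sub>R f x = f x" for x
    by (simp add: f_def serving_distance_density_def indicator_def)
  have set_f: "set_integrable lborel {0<..} f"
    using int_f by (simp add: set_integrable_def indf del: real_scaleR_def)
  have set_Ef: "set_integrable lborel {0<..} (\<lambda>x. E x * f x)"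
    using f_nonneg E_le
    by (intro set_integrable_bound[OF set_f]) (auto simp: set_borel_measurable_def abs_mult intro!: mult_left_le_one_le)
  have "outage_prob Q lam P \<beta> noise i g h Y \<tau> = (LBINT x:{0<..}. p x * f x)"
    by (simp add: outage_prob_def p_def f_def)
  also have "\<dots> = (LBINT x:{0<..}. f x - E x * f x)"
    by (rule set_lebesgue_integral_cong_AE[OF _ _ _ AE_pf]) measurable
  also have "\<dots> = (LBINT x:{0<..}. f x) - (LBINT x:{0<..}. E x * f x)"
    by (rule set_integral_diff(2)[OF set_f set_Ef])
  also have "(LBINT x:{0<..}. f x) = 1"
    unfolding set_lebesgue_integral_def indf by (rule f1)
  finally show ?thesis
    by (simp only: f_def E_def)
qed

theorem theorem5:
  fixes lam P :: "nat \<Rightarrow> real"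
    and \<alpha> \<beta> \<gamma> \<tau> noise :: real
    and N M1 i :: nat
    and M :: "'w measure" and X :: "'w \<Rightarrow> real" and Q :: "real \<Rightarrow> 'w measure"
    and g :: "'w \<Rightarrow> real" and h :: "nat \<Rightarrow> nat \<Rightarrow> 'w \<Rightarrow> real"
    and Y :: "nat \<Rightarrow> nat \<Rightarrow> 'w \<Rightarrow> real ^ 2"
  defines "lam' \<equiv> active_density \<alpha> lam P \<beta> \<gamma> N M1"
    and "G31 \<equiv> assoc_prob lam P \<beta> {1..3} 1"
    and "Pij \<equiv> assoc_prob lam P \<beta> {2..3} i"
  assumes "lam 0 > lam 2" and "lam 2 > lam 3" and "lam 3 > 0"
    and "0 < \<alpha>" and "\<alpha> < 1" and "lam 1 = \<alpha> * lam 0"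
    and "P 1 > 0" and "P 2 > 0" and "P 3 > 0"
    and "\<beta> > 2" and "noise \<ge> 0"
    and "1 \<le> M1" and "M1 \<le> N" and "\<gamma> \<ge> 0"
    and "i \<in> {2, 3}" and "\<tau> > 0"
    and "case2_model M X Q lam lam' P \<beta> i g h Y"
  shows "(Z2_approx \<beta> \<tau> \<longlongrightarrow> Z2 \<beta> \<tau>) (at_right 0) \<and>
    outage_prob Q lam P \<beta> noise i g h Y \<tau> =
      1 - 2 * pi * lam i / Pij *
        (LBINT x:{0<..}. x * exp (- (x powr \<beta>) * inverse (P i) * \<tau> * noise
           - pi * lam i * x\<^sup>2 / Pij *
             (1 + Z1 \<beta> \<tau> + lam' 1 / lam 1 * (G31 / (1 - G31)) * Z2 \<beta> \<tau>)))"
proof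
  show "(Z2_approx \<beta> \<tau> \<longlongrightarrow> Z2 \<beta> \<tau>) (at_right 0)"
    by (rule nn_integral_path_loss_plane(1)[OF \<open>\<beta> > 2\<close> zero_less_one \<open>\<tau> > 0\<close>])
  have tiers: "{1..3} = {1, 2, 3 :: nat}" "{2..3} = {2, 3 :: nat}"
    by auto
  have "lam 0 > 0" "lam 2 > 0"
    using \<open>lam 0 > lam 2\<close> \<open>lam 2 > lam 3\<close> \<open>lam 3 > 0\<close> by linarith+
  then have lam: "lam m > 0" if "m \<in> {1..3}" for m
    using that \<open>lam 3 > 0\<close> \<open>lam 1 = \<alpha> * lam 0\<close> \<open>0 < \<alpha>\<close> unfolding tiers by auto
  have P: "P m > 0" if "m \<in> {1..3}" for m
    using that \<open>P 1 > 0\<close> \<open>P 2 > 0\<close> \<open>P 3 > 0\<close> unfolding tiers by auto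
  have i: "i \<in> {1..3}" using \<open>i \<in> {2, 3}\<close> by auto
  note P_pos = \<open>P 1 > 0\<close> \<open>P 2 > 0\<close> \<open>P 3 > 0\<close> P[OF i]
  have lam_pos: "lam 1 > 0" "lam 2 > 0" "lam 3 > 0" "lam i > 0"
    by (rule lam, use i in simp)+
  \<comment> \<open>The common unit of all exponents: the total intensity of tiers 2 and 3, weighted
    by power relative to the server. It equals \<open>lam i / Pij\<close> and is also the rate in
    the serving distance density.\<close>
  define B where "B = (\<Sum>m = 2..3. lam m * (P m / P i) powr (2 / \<beta>))"
  have B: "B = lam 2 * (P 2 / P i) powr (2 / \<beta>) + lam 3 * (P 3 / P i) powr (2 / \<beta>)"
    by (simp add: B_def tiers)
  have "B > 0"
    using P_pos lam_pos by (simp add: B add_pos_pos)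
  have lam_Pij: "lam i / Pij = B"
    unfolding Pij_def assoc_prob_def B_def divide_inverse inverse_inverse_eq sum_distrib_left
    using lam_pos by (intro sum.cong) auto
  \<comment> \<open>These are the odds of tier 1 against tiers 2 and 3: the ratio of their weighted
    intensities. \<open>S\<close> is the reciprocal ratio with powers measured relative to
    \<open>P 1\<close>; changing the reference power to \<open>P i\<close> cancels in the
    ratio.\<close>
  have G31: "G31 / (1 - G31) = lam 1 * (P 1 / P i) powr (2 / \<beta>) / B"
  proof -
    define S where "S = (lam 2 * (P 2 / P 1) powr (2 / \<beta>) + lam 3 * (P 3 / P 1) powr (2 / \<beta>)) / lam 1"
    have "S > 0"
      unfolding S_def using P_pos lam_pos by (intro divide_pos_pos add_pos_pos) auto
    have "G31 = inverse (1 + S)"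
      unfolding G31_def assoc_prob_def tiers using P_pos lam_pos by (simp add: S_def add_divide_distrib)
    moreover have "1 - inverse (1 + S) = S * inverse (1 + S)"
      using \<open>S > 0\<close> by (simp add: field_simps)
    ultimately have "G31 / (1 - G31) = 1 / S"
      using \<open>S > 0\<close> by simp
    moreover have "B = (P 1 / P i) powr (2 / \<beta>) * lam 1 * S"
    proof -
      have *: "(P m / P i) powr (2 / \<beta>) = (P 1 / P i) powr (2 / \<beta>) * (P m / P 1) powr (2 / \<beta>)" if "P m > 0" for m
      proof -
        have "P m / P i = P 1 / P i * (P m / P 1)"
          using P_pos by simp
        then show ?thesis
          using P_pos that by (simp only: powr_mult divide_nonneg_pos less_imp_le)
      qed
      have "lam 1 * S = lam 2 * (P 2 / P 1) powr (2 / \<beta>) + lam 3 * (P 3 / P 1) powr (2 / \<beta>)"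
        using lam_pos by (simp add: S_def)
      then show ?thesis
        unfolding B *[OF P_pos(2)] *[OF P_pos(3)] by (simp only: mult.assoc) (simp only: distrib_left mult_ac)
    qed
    moreover have "(P 1 / P i) powr (2 / \<beta>) > 0"
      using P_pos by simp
    ultimately show ?thesis
      using lam_pos by simp
  qed
  have r: "lam' m \<ge> 0" if "m \<in> {1..3}" for m
  proof (cases "m = 1")
    case True
    have "assoc_prob lam P \<beta> {1..3} 1 \<ge> 0"
      unfolding assoc_prob_def using lam lam_pos P P_pos
      by (intro iffD2[OF inverse_nonnegative_iff_nonnegative] sum_nonneg) (auto intro!: mult_nonneg_nonneg divide_nonneg_nonneg simp: less_imp_le)
    moreover have "cached_mass \<gamma> N 1 M1 \<ge> 0"
      by (auto simp: cached_mass_def zipf_def intro!: sum_nonneg divide_nonneg_nonneg)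
    ultimately show ?thesis
      using assms True by (simp add: lam'_def active_density_def)
  qed (use lam[OF that] in \<open>simp add: lam'_def active_density_def\<close>)
  \<comment> \<open>Tiers 2 and 3 share the exponent \<open>Z1 \<beta> \<tau>\<close> and keep their
    densities, so together they contribute \<open>B\<close> times it. The weighted intensity of tier
    1 is \<open>B\<close> times the odds, corrected by \<open>lam' 1 / lam 1\<close> for the active
    nodes.\<close>
  have total: "(\<Sum>m = 1..3. lam' m * (P m / P i) powr (2 / \<beta>) * tier_exponent \<beta> \<tau> m) =
      B * (Z1 \<beta> \<tau> + lam' 1 / lam 1 * (G31 / (1 - G31)) * Z2 \<beta> \<tau>)"
  proof -
    have "lam' 2 = lam 2" "lam' 3 = lam 3"
      by (simp_all add: lam'_def active_density_def)
    then show ?thesis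
      unfolding tiers G31 using \<open>B > 0\<close> lam_pos
      by (simp add: tier_exponent_def distrib_left) (simp add: B algebra_simps)
  qed
  have "outage_prob Q lam P \<beta> noise i g h Y \<tau> =
      1 - (LBINT x:{0<..}. exp (- (\<tau> * x powr \<beta> / P i * noise +
        pi * x\<^sup>2 * (B * (Z1 \<beta> \<tau> + lam' 1 / lam 1 * (G31 / (1 - G31)) * Z2 \<beta> \<tau>)))) * serving_distance_density lam P \<beta> i x)"
    unfolding total[symmetric] using lam_Pij \<open>B > 0\<close> assms
    by (intro outage_prob_eq[OF \<open>case2_model M X Q lam lam' P \<beta> i g h Y\<close>] P i r) auto
  also have "(LBINT x:{0<..}. exp (- (\<tau> * x powr \<beta> / P i * noise +
        pi * x\<^sup>2 * (B * (Z1 \<beta> \<tau> + lam' 1 / lam 1 * (G31 / (1 - G31)) * Z2 \<beta> \<tau>)))) * serving_distance_density lam P \<beta> i x) =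
      (LBINT x:{0<..}. 2 * pi * lam i / Pij * (x * exp (- (x powr \<beta>) * inverse (P i) * \<tau> * noise
           - pi * lam i * x\<^sup>2 / Pij *
             (1 + Z1 \<beta> \<tau> + lam' 1 / lam 1 * (G31 / (1 - G31)) * Z2 \<beta> \<tau>))))"
  proof (rule set_lebesgue_integral_cong)
    have Pij: "2 * pi * lam i / Pij = 2 * pi * B"
      by (simp add: lam_Pij[symmetric])
    define z where "z = Z1 \<beta> \<tau> + lam' 1 / lam 1 * (G31 / (1 - G31)) * Z2 \<beta> \<tau>"
    have "exp (- (\<tau> * x powr \<beta> / P i * noise + pi * x\<^sup>2 * (B * z))) * serving_distance_density lam P \<beta> i x =
        2 * pi * lam i / Pij * (x * exp (- (x powr \<beta>) * inverse (P i) * \<tau> * noise - pi * lam i * x\<^sup>2 / Pij * (1 + z)))"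
      if "x > 0" for x
    proof -
      have "serving_distance_density lam P \<beta> i x = 2 * pi * B * x * exp (- pi * x\<^sup>2 * B)"
        unfolding serving_distance_density_def Pij_def[symmetric] B_def[symmetric] Pij using that by simp
      moreover have "pi * lam i * x\<^sup>2 / Pij = pi * B * x\<^sup>2"
        by (simp add: lam_Pij[symmetric])
      moreover note Pij
      \<comment> \<open>Merging with the exponential of the serving density produces the summand 1
        beside the interference terms.\<close>
      moreover have "exp (- (\<tau> * x powr \<beta> / P i * noise + pi * x\<^sup>2 * (B * z))) * exp (- pi * x\<^sup>2 * B) =
          exp (- (x powr \<beta>) * inverse (P i) * \<tau> * noise - pi * B * x\<^sup>2 * (1 + z))"
        by (simp add: exp_add[symmetric] divide_inverse algebra_simps)
      ultimately show ?thesis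
        by (simp add: mult_ac)
    qed
    then show "\<forall>x. x \<in> {0<..} \<longrightarrow> exp (- (\<tau> * x powr \<beta> / P i * noise +
        pi * x\<^sup>2 * (B * (Z1 \<beta> \<tau> + lam' 1 / lam 1 * (G31 / (1 - G31)) * Z2 \<beta> \<tau>)))) * serving_distance_density lam P \<beta> i x =
      2 * pi * lam i / Pij * (x * exp (- (x powr \<beta>) * inverse (P i) * \<tau> * noise
           - pi * lam i * x\<^sup>2 / Pij *
             (1 + Z1 \<beta> \<tau> + lam' 1 / lam 1 * (G31 / (1 - G31)) * Z2 \<beta> \<tau>)))"
      by (simp add: z_def add.assoc)
  qed simp
  also have "\<dots> = 2 * pi * lam i / Pij * (LBINT x:{0<..}. x * exp (- (x powr \<beta>) * inverse (P i) * \<tau> * noise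
           - pi * lam i * x\<^sup>2 / Pij *
             (1 + Z1 \<beta> \<tau> + lam' 1 / lam 1 * (G31 / (1 - G31)) * Z2 \<beta> \<tau>)))"
    by (rule set_integral_mult_right)
  finally show "outage_prob Q lam P \<beta> noise i g h Y \<tau> =
      1 - 2 * pi * lam i / Pij *
        (LBINT x:{0<..}. x * exp (- (x powr \<beta>) * inverse (P i) * \<tau> * noise
           - pi * lam i * x\<^sup>2 / Pij *
             (1 + Z1 \<beta> \<tau> + lam' 1 / lam 1 * (G31 / (1 - G31)) * Z2 \<beta> \<tau>)))" .
qed

end
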